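(* Let $k$ be a field, let $A$ be an associative unital $k$-algebra, and let $\lambda,\mu\in k$. Then the following linear maps $W,Z,X:A\otimes A\to A\otimes A$ form a Yang-Baxter system (WXZ-system) with $V=V'=A$: for $a,b\in A$, $$W(a\otimes b)=\lambda\,1\otimes ab+ab\otimes 1-b\otimes a,$$ $$Z(a\otimes b)=1\otimes ab+\mu\,ab\otimes 1-b\otimes a,$$ $$X(a\otimes b)=1\otimes ab+ab\otimes 1-b\otimes a.$$
   Context: All tensor products are over $k$. Given vector spaces $V,V',V''$ and linear maps $R:V\otimes V'\to V\otimes V'$, $S:V\otimes V''\to V\otimes V''$, $T:V'\otimes V''\to V'\otimes V''$, the Yang-Baxter commutator is the map $[R,S,T]:V\otimes V'\otimes V''\to V\otimes V'\otimes V''$ defined by $$[R,S,T]=R_{12}\circ S_{13}\circ T_{23}-T_{23}\circ S_{13}\circ R_{12},$$ where the subscripts indicate the tensor factors on which the map acts (it acts as the identity on the remaining factor). Let $V,V'$ be vector spaces. A system of linear maps $W:V\otimes V\to V\otimes V$, $Z:V'\otimes V'\to V'\otimes V'$, $X:V\otimes V'\to V\otimes V'$ is called a WXZ-system, or a Yang-Baxter system, if $$[W,W,W]=0,\qquad [Z,Z,Z]=0,\qquad [W,X,X]=0,\qquad [X,X,Z]=0 .$$ *)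

theory Defs
  imports "HOL-Algebra.AbelCoset" "Jordan_Normal_Form.Missing_VectorSpace"
begin

text \<open>The locale \<^locale>\<open>algebra\<close> of HOL-Algebra is restricted to commutative algebras. Here the
  multiplication need not be commutative, and the zero algebra is not excluded.\<close>

locale unital_algebra = vectorspace K A + A: ring A for K and A +
  assumes smult_mult_left:
      "\<lbrakk>c \<in> carrier K; a \<in> carrier A; b \<in> carrier A\<rbrakk> \<Longrightarrow>
        (c \<odot>\<^bsub>A\<^esub> a) \<otimes>\<^bsub>A\<^esub> b = c \<odot>\<^bsub>A\<^esub> (a \<otimes>\<^bsub>A\<^esub> b)"
    and smult_mult_right:
      "\<lbrakk>c \<in> carrier K; a \<in> carrier A; b \<in> carrier A\<rbrakk> \<Longrightarrow>
        a \<otimes>\<^bsub>A\<^esub> (c \<odot>\<^bsub>A\<^esub> b) = c \<odot>\<^bsub>A\<^esub> (a \<otimes>\<^bsub>A\<^esub> b)"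


section \<open>The tensor product of two vector spaces\<close>

text \<open>\<open>V \<otimes> W\<close> is the free vector space on the set \<open>V \<times> W\<close> modulo the subspace spanned by the
  bilinearity relations. Its elements are cosets of that subspace.\<close>

definition free_space :: "('k, 'r) ring_scheme \<Rightarrow> 's set \<Rightarrow> ('k, 's \<Rightarrow> 'k) module" where
  "free_space K S = (ring.func_space K S)
     \<lparr>carrier := {f \<in> S \<rightarrow>\<^sub>E carrier K. finite {s \<in> S. f s \<noteq> \<zero>\<^bsub>K\<^esub>}}\<rparr>"

definition free_gen :: "('k, 'r) ring_scheme \<Rightarrow> 's set \<Rightarrow> 's \<Rightarrow> 's \<Rightarrow> 'k" where
  "free_gen K S s = (\<lambda>t\<in>S. if t = s then \<one>\<^bsub>K\<^esub> else \<zero>\<^bsub>K\<^esub>)"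

text \<open>The fields \<open>mult\<close> and \<open>one\<close> of a module record play no role for a vector space.\<close>

definition quotient_space :: "('k, 'v, 'm) module_scheme \<Rightarrow> 'v set \<Rightarrow> ('k, 'v set) module" where
  "quotient_space V N =
     \<lparr>carrier = a_rcosets\<^bsub>V\<^esub> N, mult = (\<lambda>X Y. N), one = N, zero = N, add = set_add V,
      smult = (\<lambda>c X. \<Union>x\<in>X. N +>\<^bsub>V\<^esub> (c \<odot>\<^bsub>V\<^esub> x))\<rparr>"

definition tensor_relations ::
    "('k, 'r) ring_scheme \<Rightarrow> ('k, 'v, 'm) module_scheme \<Rightarrow> ('k, 'w, 'n) module_scheme
      \<Rightarrow> ('v \<times> 'w \<Rightarrow> 'k) set" where
  "tensor_relations K V W =
    (let F = free_space K (carrier V \<times> carrier W);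
         \<delta> = (\<lambda>v w. free_gen K (carrier V \<times> carrier W) (v, w))
     in {\<delta> (v \<oplus>\<^bsub>V\<^esub> v') w \<ominus>\<^bsub>F\<^esub> (\<delta> v w \<oplus>\<^bsub>F\<^esub> \<delta> v' w) | v v' w.
           v \<in> carrier V \<and> v' \<in> carrier V \<and> w \<in> carrier W}
      \<union> {\<delta> v (w \<oplus>\<^bsub>W\<^esub> w') \<ominus>\<^bsub>F\<^esub> (\<delta> v w \<oplus>\<^bsub>F\<^esub> \<delta> v w') | v w w'.
           v \<in> carrier V \<and> w \<in> carrier W \<and> w' \<in> carrier W}
      \<union> {\<delta> (c \<odot>\<^bsub>V\<^esub> v) w \<ominus>\<^bsub>F\<^esub> (c \<odot>\<^bsub>F\<^esub> \<delta> v w) | c v w.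
           c \<in> carrier K \<and> v \<in> carrier V \<and> w \<in> carrier W}
      \<union> {\<delta> v (c \<odot>\<^bsub>W\<^esub> w) \<ominus>\<^bsub>F\<^esub> (c \<odot>\<^bsub>F\<^esub> \<delta> v w) | c v w.
           c \<in> carrier K \<and> v \<in> carrier V \<and> w \<in> carrier W})"

definition tensor_kernel ::
    "('k, 'r) ring_scheme \<Rightarrow> ('k, 'v, 'm) module_scheme \<Rightarrow> ('k, 'w, 'n) module_scheme
      \<Rightarrow> ('v \<times> 'w \<Rightarrow> 'k) set" where
  "tensor_kernel K V W =
     module.span K (free_space K (carrier V \<times> carrier W)) (tensor_relations K V W)"

definition tensor ::
    "('k, 'r) ring_scheme \<Rightarrow> ('k, 'v, 'm) module_scheme \<Rightarrow> ('k, 'w, 'n) module_scheme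
      \<Rightarrow> ('k, ('v \<times> 'w \<Rightarrow> 'k) set) module" where
  "tensor K V W =
     quotient_space (free_space K (carrier V \<times> carrier W)) (tensor_kernel K V W)"

definition pure_tensor ::
    "('k, 'r) ring_scheme \<Rightarrow> ('k, 'v, 'm) module_scheme \<Rightarrow> ('k, 'w, 'n) module_scheme
      \<Rightarrow> 'v \<Rightarrow> 'w \<Rightarrow> ('v \<times> 'w \<Rightarrow> 'k) set" where
  "pure_tensor K V W v w =
     tensor_kernel K V W +>\<^bsub>free_space K (carrier V \<times> carrier W)\<^esub>
       free_gen K (carrier V \<times> carrier W) (v, w)"

text \<open>\<open>g\<close> is the linear map \<open>V \<otimes> W \<rightarrow> U\<close> with \<open>g (v \<otimes> w) = f v w\<close>. Such a \<open>g\<close> exists whenever \<open>f\<close>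
  is bilinear; on the carrier of \<open>V \<otimes> W\<close> it is determined by \<open>f\<close>.\<close>

definition tensor_induced ::
    "('k, 'r) ring_scheme \<Rightarrow> ('k, 'v, 'm) module_scheme \<Rightarrow> ('k, 'w, 'n) module_scheme
      \<Rightarrow> ('k, 'u, 'l) module_scheme \<Rightarrow> ('v \<Rightarrow> 'w \<Rightarrow> 'u) \<Rightarrow> (('v \<times> 'w \<Rightarrow> 'k) set \<Rightarrow> 'u) \<Rightarrow> bool" where
  "tensor_induced K V W U f g \<longleftrightarrow>
     linear_map K (tensor K V W) U g \<and>
     (\<forall>v\<in>carrier V. \<forall>w\<in>carrier W. g (pure_tensor K V W v w) = f v w)"

text \<open>The value of \<open>g\<close> off the carrier is fixed by extensionality, so that \<open>THE\<close> is justified.\<close>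

definition tensor_lift ::
    "('k, 'r) ring_scheme \<Rightarrow> ('k, 'v, 'm) module_scheme \<Rightarrow> ('k, 'w, 'n) module_scheme
      \<Rightarrow> ('k, 'u, 'l) module_scheme \<Rightarrow> ('v \<Rightarrow> 'w \<Rightarrow> 'u) \<Rightarrow> ('v \<times> 'w \<Rightarrow> 'k) set \<Rightarrow> 'u" where
  "tensor_lift K V W U f =
     (THE g. g \<in> extensional (carrier (tensor K V W)) \<and> tensor_induced K V W U f g)"

definition tensor_map ::
    "('k, 'r) ring_scheme \<Rightarrow> ('k, 'v, 'm) module_scheme \<Rightarrow> ('k, 'w, 'n) module_scheme
      \<Rightarrow> ('k, 'v2, 'm2) module_scheme \<Rightarrow> ('k, 'w2, 'n2) module_scheme
      \<Rightarrow> ('v \<Rightarrow> 'v2) \<Rightarrow> ('w \<Rightarrow> 'w2) \<Rightarrow> ('v \<times> 'w \<Rightarrow> 'k) set \<Rightarrow> ('v2 \<times> 'w2 \<Rightarrow> 'k) set" where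
  "tensor_map K V W V2 W2 f g =
     tensor_lift K V W (tensor K V2 W2) (\<lambda>v w. pure_tensor K V2 W2 (f v) (g w))"


section \<open>The Yang-Baxter commutator\<close>

text \<open>\<open>U \<otimes> V \<otimes> W\<close> is read as \<open>(U \<otimes> V) \<otimes> W\<close>.\<close>

definition tensor3 ::
    "('k, 'r) ring_scheme \<Rightarrow> ('k, 'u, 'l) module_scheme \<Rightarrow> ('k, 'v, 'm) module_scheme
      \<Rightarrow> ('k, 'w, 'n) module_scheme \<Rightarrow> ('k, (('u \<times> 'v \<Rightarrow> 'k) set \<times> 'w \<Rightarrow> 'k) set) module" where
  "tensor3 K U V W = tensor K (tensor K U V) W"

definition pure_tensor3 ::
    "('k, 'r) ring_scheme \<Rightarrow> ('k, 'u, 'l) module_scheme \<Rightarrow> ('k, 'v, 'm) module_scheme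
      \<Rightarrow> ('k, 'w, 'n) module_scheme
      \<Rightarrow> 'u \<Rightarrow> 'v \<Rightarrow> 'w \<Rightarrow> (('u \<times> 'v \<Rightarrow> 'k) set \<times> 'w \<Rightarrow> 'k) set" where
  "pure_tensor3 K U V W u v w = pure_tensor K (tensor K U V) W (pure_tensor K U V u v) w"

text \<open>The canonical isomorphisms \<open>(u \<otimes> v) \<otimes> w \<mapsto> u \<otimes> (v \<otimes> w)\<close>, its inverse, and
  \<open>(u \<otimes> v) \<otimes> w \<mapsto> (u \<otimes> w) \<otimes> v\<close>.\<close>

definition tensor_assoc ::
    "('k, 'r) ring_scheme \<Rightarrow> ('k, 'u, 'l) module_scheme \<Rightarrow> ('k, 'v, 'm) module_scheme
      \<Rightarrow> ('k, 'w, 'n) module_scheme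
      \<Rightarrow> (('u \<times> 'v \<Rightarrow> 'k) set \<times> 'w \<Rightarrow> 'k) set \<Rightarrow> ('u \<times> ('v \<times> 'w \<Rightarrow> 'k) set \<Rightarrow> 'k) set" where
  "tensor_assoc K U V W =
    (let M = tensor K U (tensor K V W)
     in tensor_lift K (tensor K U V) W M (\<lambda>x w.
          tensor_lift K U V M
            (\<lambda>u v. pure_tensor K U (tensor K V W) u (pure_tensor K V W v w)) x))"

definition tensor_assoc_inv ::
    "('k, 'r) ring_scheme \<Rightarrow> ('k, 'u, 'l) module_scheme \<Rightarrow> ('k, 'v, 'm) module_scheme
      \<Rightarrow> ('k, 'w, 'n) module_scheme
      \<Rightarrow> ('u \<times> ('v \<times> 'w \<Rightarrow> 'k) set \<Rightarrow> 'k) set \<Rightarrow> (('u \<times> 'v \<Rightarrow> 'k) set \<times> 'w \<Rightarrow> 'k) set" where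
  "tensor_assoc_inv K U V W =
    (let M = tensor3 K U V W
     in tensor_lift K U (tensor K V W) M (\<lambda>u y.
          tensor_lift K V W M (\<lambda>v w. pure_tensor3 K U V W u v w) y))"

definition tensor_swap23 ::
    "('k, 'r) ring_scheme \<Rightarrow> ('k, 'u, 'l) module_scheme \<Rightarrow> ('k, 'v, 'm) module_scheme
      \<Rightarrow> ('k, 'w, 'n) module_scheme
      \<Rightarrow> (('u \<times> 'v \<Rightarrow> 'k) set \<times> 'w \<Rightarrow> 'k) set \<Rightarrow> (('u \<times> 'w \<Rightarrow> 'k) set \<times> 'v \<Rightarrow> 'k) set" where
  "tensor_swap23 K U V W =
    (let M = tensor3 K U W V
     in tensor_lift K (tensor K U V) W M (\<lambda>x w.
          tensor_lift K U V M (\<lambda>u v. pure_tensor3 K U W V u w v) x))"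

definition leg12 ::
    "('k, 'r) ring_scheme \<Rightarrow> ('k, 'u, 'l) module_scheme \<Rightarrow> ('k, 'v, 'm) module_scheme
      \<Rightarrow> ('k, 'w, 'n) module_scheme
      \<Rightarrow> (('u \<times> 'v \<Rightarrow> 'k) set \<Rightarrow> ('u \<times> 'v \<Rightarrow> 'k) set)
      \<Rightarrow> (('u \<times> 'v \<Rightarrow> 'k) set \<times> 'w \<Rightarrow> 'k) set \<Rightarrow> (('u \<times> 'v \<Rightarrow> 'k) set \<times> 'w \<Rightarrow> 'k) set" where
  "leg12 K U V W R = tensor_map K (tensor K U V) W (tensor K U V) W R id"

definition leg23 ::
    "('k, 'r) ring_scheme \<Rightarrow> ('k, 'u, 'l) module_scheme \<Rightarrow> ('k, 'v, 'm) module_scheme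
      \<Rightarrow> ('k, 'w, 'n) module_scheme
      \<Rightarrow> (('v \<times> 'w \<Rightarrow> 'k) set \<Rightarrow> ('v \<times> 'w \<Rightarrow> 'k) set)
      \<Rightarrow> (('u \<times> 'v \<Rightarrow> 'k) set \<times> 'w \<Rightarrow> 'k) set \<Rightarrow> (('u \<times> 'v \<Rightarrow> 'k) set \<times> 'w \<Rightarrow> 'k) set" where
  "leg23 K U V W T =
     tensor_assoc_inv K U V W \<circ>
     tensor_map K U (tensor K V W) U (tensor K V W) id T \<circ>
     tensor_assoc K U V W"

definition leg13 ::
    "('k, 'r) ring_scheme \<Rightarrow> ('k, 'u, 'l) module_scheme \<Rightarrow> ('k, 'v, 'm) module_scheme
      \<Rightarrow> ('k, 'w, 'n) module_scheme
      \<Rightarrow> (('u \<times> 'w \<Rightarrow> 'k) set \<Rightarrow> ('u \<times> 'w \<Rightarrow> 'k) set)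
      \<Rightarrow> (('u \<times> 'v \<Rightarrow> 'k) set \<times> 'w \<Rightarrow> 'k) set \<Rightarrow> (('u \<times> 'v \<Rightarrow> 'k) set \<times> 'w \<Rightarrow> 'k) set" where
  "leg13 K U V W S =
     tensor_swap23 K U W V \<circ> leg12 K U W V S \<circ> tensor_swap23 K U V W"

definition yb_commutator ::
    "('k, 'r) ring_scheme \<Rightarrow> ('k, 'u, 'l) module_scheme \<Rightarrow> ('k, 'v, 'm) module_scheme
      \<Rightarrow> ('k, 'w, 'n) module_scheme
      \<Rightarrow> (('u \<times> 'v \<Rightarrow> 'k) set \<Rightarrow> ('u \<times> 'v \<Rightarrow> 'k) set)
      \<Rightarrow> (('u \<times> 'w \<Rightarrow> 'k) set \<Rightarrow> ('u \<times> 'w \<Rightarrow> 'k) set)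
      \<Rightarrow> (('v \<times> 'w \<Rightarrow> 'k) set \<Rightarrow> ('v \<times> 'w \<Rightarrow> 'k) set)
      \<Rightarrow> (('u \<times> 'v \<Rightarrow> 'k) set \<times> 'w \<Rightarrow> 'k) set \<Rightarrow> (('u \<times> 'v \<Rightarrow> 'k) set \<times> 'w \<Rightarrow> 'k) set" where
  "yb_commutator K U V W R S T =
    (let R12 = leg12 K U V W R; S13 = leg13 K U V W S; T23 = leg23 K U V W T
     in (\<lambda>x. (R12 \<circ> S13 \<circ> T23) x \<ominus>\<^bsub>tensor3 K U V W\<^esub> (T23 \<circ> S13 \<circ> R12) x))"

definition yb_commutator_vanishes ::
    "('k, 'r) ring_scheme \<Rightarrow> ('k, 'u, 'l) module_scheme \<Rightarrow> ('k, 'v, 'm) module_scheme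
      \<Rightarrow> ('k, 'w, 'n) module_scheme
      \<Rightarrow> (('u \<times> 'v \<Rightarrow> 'k) set \<Rightarrow> ('u \<times> 'v \<Rightarrow> 'k) set)
      \<Rightarrow> (('u \<times> 'w \<Rightarrow> 'k) set \<Rightarrow> ('u \<times> 'w \<Rightarrow> 'k) set)
      \<Rightarrow> (('v \<times> 'w \<Rightarrow> 'k) set \<Rightarrow> ('v \<times> 'w \<Rightarrow> 'k) set) \<Rightarrow> bool" where
  "yb_commutator_vanishes K U V W R S T \<longleftrightarrow>
     (\<forall>x\<in>carrier (tensor3 K U V W). yb_commutator K U V W R S T x = \<zero>\<^bsub>tensor3 K U V W\<^esub>)"

definition wxz_system ::
    "('k, 'r) ring_scheme \<Rightarrow> ('k, 'v, 'm) module_scheme \<Rightarrow> ('k, 'w, 'n) module_scheme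
      \<Rightarrow> (('v \<times> 'v \<Rightarrow> 'k) set \<Rightarrow> ('v \<times> 'v \<Rightarrow> 'k) set)
      \<Rightarrow> (('v \<times> 'w \<Rightarrow> 'k) set \<Rightarrow> ('v \<times> 'w \<Rightarrow> 'k) set)
      \<Rightarrow> (('w \<times> 'w \<Rightarrow> 'k) set \<Rightarrow> ('w \<times> 'w \<Rightarrow> 'k) set) \<Rightarrow> bool" where
  "wxz_system K V V' W X Z \<longleftrightarrow>
     linear_map K (tensor K V V) (tensor K V V) W \<and>
     linear_map K (tensor K V V') (tensor K V V') X \<and>
     linear_map K (tensor K V' V') (tensor K V' V') Z \<and>
     yb_commutator_vanishes K V V V W W W \<and>
     yb_commutator_vanishes K V' V' V' Z Z Z \<and>
     yb_commutator_vanishes K V V V' W X X \<and>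
     yb_commutator_vanishes K V V' V' X X Z"

end

theory Submission
  imports Defs
begin

text \<open>All three maps belong to the family
  \<open>R\<^sub>p\<^sub>,\<^sub>q (a \<otimes> b) = p (1 \<otimes> ab) + q (ab \<otimes> 1) - b \<otimes> a\<close>: \<open>W = R\<^sub>\<lambda>\<^sub>,\<^sub>1\<close>, \<open>Z = R\<^sub>1\<^sub>,\<^sub>\<mu>\<close>, \<open>X = R\<^sub>1\<^sub>,\<^sub>1\<close>.
  On \<open>a \<otimes> b \<otimes> c\<close> both terms of \<open>[R\<^sub>p\<^sub>,\<^sub>q, R\<^sub>r\<^sub>,\<^sub>s, R\<^sub>t\<^sub>,\<^sub>u]\<close> are combinations of the same ten
  pure tensors, and the coefficients agree whenever \<open>q = s = u = 1\<close> and \<open>t = r\<close>, or \<open>p = r = t = 1\<close> and \<open>s = q\<close>. These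
  two cases cover the four commutators.\<close>

section \<open>Free vector spaces and quotient spaces\<close>

text \<open>Tensor products are concrete coset spaces and \<open>tensor_lift\<close> is a
  \<open>THE\<close> term, so nothing can be said about the legs until existence and uniqueness of
  induced maps are established. This is why the universal property is derived from the free space;
  afterwards only linearity and values on pure tensors matter. Comparing coefficients is a
  sufficient argument, not an equivalence: for special arguments, or in the zero algebra, the ten
  pure tensors can be dependent or even equal. Combinations are therefore indexed by list positions
  and never by the tensors themselves. The two parameter cases are mirror images. Reversing the
  order of the tensor factors and passing to the opposite algebra turns
  \<open>R\<^sub>p\<^sub>,\<^sub>q\<close> into \<open>R\<^sub>q\<^sub>,\<^sub>p\<close>; it
  exchanges the first and third operators, hence \<open>p\<close> with \<open>u\<close>,
  \<open>q\<close> with \<open>t\<close>, and \<open>r\<close> with \<open>s\<close>.\<close>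

lemma linear_mapI:
  assumes "vectorspace K V" "vectorspace K W"
    and "\<And>v. v \<in> carrier V \<Longrightarrow> T v \<in> carrier W"
    and "\<And>v w. v \<in> carrier V \<Longrightarrow> w \<in> carrier V \<Longrightarrow> T (v \<oplus>\<^bsub>V\<^esub> w) = T v \<oplus>\<^bsub>W\<^esub> T w"
    and "\<And>c v. c \<in> carrier K \<Longrightarrow> v \<in> carrier V \<Longrightarrow> T (c \<odot>\<^bsub>V\<^esub> v) = c \<odot>\<^bsub>W\<^esub> T v"
  shows "linear_map K V W T"
  using assms
  by (auto simp: linear_map_def vectorspace_def mod_hom_def mod_hom_axioms_def module_hom_def)

lemma linear_mapD:
  assumes "linear_map K V W T"
  shows "vectorspace K V" "vectorspace K W"
    and "v \<in> carrier V \<Longrightarrow> T v \<in> carrier W"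
    and "v \<in> carrier V \<Longrightarrow> w \<in> carrier V \<Longrightarrow> T (v \<oplus>\<^bsub>V\<^esub> w) = T v \<oplus>\<^bsub>W\<^esub> T w"
    and "c \<in> carrier K \<Longrightarrow> v \<in> carrier V \<Longrightarrow> T (c \<odot>\<^bsub>V\<^esub> v) = c \<odot>\<^bsub>W\<^esub> T v"
    and "v \<in> carrier V \<Longrightarrow> w \<in> carrier V \<Longrightarrow> T (v \<ominus>\<^bsub>V\<^esub> w) = T v \<ominus>\<^bsub>W\<^esub> T w"
    and "T \<zero>\<^bsub>V\<^esub> = \<zero>\<^bsub>W\<^esub>"
proof -
  interpret linear_map K V W T by fact
  show "vectorspace K V" "vectorspace K W" ..
  show "v \<in> carrier V \<Longrightarrow> T v \<in> carrier W" 
    and "v \<in> carrier V \<Longrightarrow> w \<in> carrier V \<Longrightarrow> T (v \<oplus>\<^bsub>V\<^esub> w) = T v \<oplus>\<^bsub>W\<^esub> T w"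
    and "c \<in> carrier K \<Longrightarrow> v \<in> carrier V \<Longrightarrow> T (c \<odot>\<^bsub>V\<^esub> v) = c \<odot>\<^bsub>W\<^esub> T v"
    and "v \<in> carrier V \<Longrightarrow> w \<in> carrier V \<Longrightarrow> T (v \<ominus>\<^bsub>V\<^esub> w) = T v \<ominus>\<^bsub>W\<^esub> T w"
    and "T \<zero>\<^bsub>V\<^esub> = \<zero>\<^bsub>W\<^esub>"
    by auto
qed

lemma linear_map_comp:
  assumes "linear_map K U V f" "linear_map K V W g"
  shows "linear_map K U W (g \<circ> f)"
  by (rule linear_mapI) (simp_all add: linear_mapD[OF assms(1)] linear_mapD[OF assms(2)])

lemma free_space_simps:
  assumes "ring K"
  shows
  "carrier (free_space K S) = {f \<in> S \<rightarrow>\<^sub>E carrier K. finite {s \<in> S. f s \<noteq> \<zero>\<^bsub>K\<^esub>}}"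
  "\<zero>\<^bsub>free_space K S\<^esub> = (\<lambda>s\<in>S. \<zero>\<^bsub>K\<^esub>)"
  "f \<oplus>\<^bsub>free_space K S\<^esub> g = (\<lambda>s\<in>S. f s \<oplus>\<^bsub>K\<^esub> g s)"
  "c \<odot>\<^bsub>free_space K S\<^esub> f = (\<lambda>s\<in>S. c \<otimes>\<^bsub>K\<^esub> f s)"
  by (simp_all add: free_space_def ring.func_space_def[OF assms])

lemma (in abelian_group) minus_eq_zero_iff:
  assumes "x \<in> carrier G" "y \<in> carrier G"
  shows "x \<ominus> y = \<zero> \<longleftrightarrow> x = y"
proof
  assume "x \<ominus> y = \<zero>"
  then have "(x \<ominus> y) \<oplus> y = \<zero> \<oplus> y" by simp
  with assms show "x = y" by (simp add: minus_eq a_assoc l_neg)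
qed (use assms in \<open>simp add: minus_eq r_neg\<close>)

context field
begin

lemmas free_space_simps_field = free_space_simps[OF ring_axioms]

text \<open>The support of a sum lies in the union of the supports, and scaling does not enlarge a
  support; so the finitely supported functions are a submodule of
  \<open>func_space S\<close>.\<close>

lemma free_space_vectorspace: "vectorspace R (free_space R S)"
proof -
  interpret F: module R "func_space S" by (rule func_space_is_module)
  have "submodule R {f \<in> S \<rightarrow>\<^sub>E carrier R. finite {s \<in> S. f s \<noteq> \<zero>}} (func_space S)"
  proof (rule submodule.intro)
    fix v w
    assume "v \<in> {f \<in> S \<rightarrow>\<^sub>E carrier R. finite {s \<in> S. f s \<noteq> \<zero>}}"
      and "w \<in> {f \<in> S \<rightarrow>\<^sub>E carrier R. finite {s \<in> S. f s \<noteq> \<zero>}}"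
    then have v: "v \<in> S \<rightarrow>\<^sub>E carrier R" and w: "w \<in> S \<rightarrow>\<^sub>E carrier R"
      and fin: "finite ({s \<in> S. v s \<noteq> \<zero>} \<union> {s \<in> S. w s \<noteq> \<zero>})"
      by auto
    have "finite {s \<in> S. v s \<oplus> w s \<noteq> \<zero>}"
      by (rule finite_subset[OF _ fin]) auto
    with v w show "v \<oplus>\<^bsub>func_space S\<^esub> w \<in> {f \<in> S \<rightarrow>\<^sub>E carrier R. finite {s \<in> S. f s \<noteq> \<zero>}}"
      by (auto simp: func_space_def PiE_iff cong: conj_cong)
  next
    fix c v
    assume c: "c \<in> carrier R" 
      and "v \<in> {f \<in> S \<rightarrow>\<^sub>E carrier R. finite {s \<in> S. f s \<noteq> \<zero>}}"
    then have v: "v \<in> S \<rightarrow>\<^sub>E carrier R" and fin: "finite {s \<in> S. v s \<noteq> \<zero>}"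
      by auto
    have "finite {s \<in> S. c \<otimes> v s \<noteq> \<zero>}"
      using c by (auto intro: finite_subset[OF _ fin])
    with v c show "c \<odot>\<^bsub>func_space S\<^esub> v \<in> {f \<in> S \<rightarrow>\<^sub>E carrier R. finite {s \<in> S. f s \<noteq> \<zero>}}"
      by (auto simp: func_space_def PiE_iff cong: conj_cong)
  qed (auto simp: func_space_def F.module_axioms[unfolded func_space_def] cong: conj_cong)
  then have "module R (free_space R S)"
    unfolding free_space_def by (rule F.submodule_is_module)
  then show ?thesis
    by (simp add: vectorspace_def field_axioms)
qed

lemma free_gen_closed: "s \<in> S \<Longrightarrow> free_gen R S s \<in> carrier (free_space R S)"
  by (auto simp: free_space_simps_field free_gen_def cong: conj_cong)

text \<open>Induction on the support, splitting off one point at a time.\<close>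

lemma free_space_induct [consumes 1, case_names zero add]:
  assumes f: "f \<in> carrier (free_space R S)"
    and zero: "P \<zero>\<^bsub>free_space R S\<^esub>"
    and add: "\<And>c s g. \<lbrakk>c \<in> carrier R; s \<in> S; g \<in> carrier (free_space R S); P g\<rbrakk> \<Longrightarrow>
      P (c \<odot>\<^bsub>free_space R S\<^esub> free_gen R S s \<oplus>\<^bsub>free_space R S\<^esub> g)"
  shows "P f"
proof -
  have "P f" if "finite B" "B = {s \<in> S. f s \<noteq> \<zero>}" "f \<in> S \<rightarrow>\<^sub>E carrier R" for B f
    using that
  proof (induction B arbitrary: f rule: finite_induct)
    case empty
    then have "f = \<zero>\<^bsub>free_space R S\<^esub>"
      by (auto simp: free_space_simps_field PiE_iff extensional_def fun_eq_iff)
    with zero show ?case by simp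
  next
    case (insert b B)
    \<comment> \<open>\<open>f\<close> with its value at \<open>b\<close> erased, so that the
      support shrinks from \<open>insert b B\<close> to \<open>B\<close>.\<close>
    define g where "g = (\<lambda>s\<in>S. if s = b then \<zero> else f s)"
    have b: "b \<in> S" "f b \<in> carrier R" using insert.prems by auto
    have g: "g \<in> S \<rightarrow>\<^sub>E carrier R" and Bg: "B = {s \<in> S. g s \<noteq> \<zero>}"
      using insert by (auto simp: g_def split: if_splits)
    have "P g" by (rule insert.IH[OF Bg g])
    moreover have "g \<in> carrier (free_space R S)"
      using g insert.hyps(1) by (simp add: free_space_simps_field Bg)
    moreover have "f = f b \<odot>\<^bsub>free_space R S\<^esub> free_gen R S b \<oplus>\<^bsub>free_space R S\<^esub> g"
      using insert.prems(2) b
      by (auto simp: fun_eq_iff free_space_simps_field free_gen_def g_def PiE_iff extensional_def)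
    ultimately show ?case using add[OF b(2,1)] by metis
  qed
  with f show ?thesis by (simp add: free_space_simps_field)
qed

end

text \<open>The linear extension of \<open>f\<close> from the basis \<open>free_gen K S s\<close>.
  Summing over the support keeps the index set finite, but makes it depend on
  \<open>g\<close>.\<close>

definition free_lift ::
    "('k, 'r) ring_scheme \<Rightarrow> 's set \<Rightarrow> ('k, 'u, 'l) module_scheme \<Rightarrow> ('s \<Rightarrow> 'u)
      \<Rightarrow> ('s \<Rightarrow> 'k) \<Rightarrow> 'u" where
  "free_lift K S U f g = (\<Oplus>\<^bsub>U\<^esub>s\<in>{s \<in> S. g s \<noteq> \<zero>\<^bsub>K\<^esub>}. g s \<odot>\<^bsub>U\<^esub> f s)"

context vectorspace
begin

text \<open>Points outside the support contribute zero. Enlarging the index set allows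
  \<open>g\<close>, \<open>h\<close> and their sum to be summed over one common set, which is what
  additivity requires.\<close>

lemma free_lift_eq:
  assumes f: "f \<in> S \<rightarrow> carrier V" and g: "g \<in> carrier (free_space K S)"
    and B: "finite B" "{s \<in> S. g s \<noteq> \<zero>\<^bsub>K\<^esub>} \<subseteq> B" "B \<subseteq> S"
  shows "free_lift K S V f g = (\<Oplus>\<^bsub>V\<^esub>s\<in>B. g s \<odot>\<^bsub>V\<^esub> f s)"
  unfolding free_lift_def
proof (rule add.finprod_mono_neutral_cong_left)
  show "\<And>i. i \<in> B - {s \<in> S. g s \<noteq> \<zero>\<^bsub>K\<^esub>} \<Longrightarrow> g i \<odot>\<^bsub>V\<^esub> f i = \<zero>\<^bsub>V\<^esub>"
    using f B by (auto simp: Pi_iff)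
  show "(\<lambda>s. g s \<odot>\<^bsub>V\<^esub> f s) \<in> B \<rightarrow> carrier V"
    using f g B by (auto simp: free_space_simps_field PiE_iff Pi_iff)
qed (use B in auto)

lemma free_lift_linear:
  assumes f: "f \<in> S \<rightarrow> carrier V"
  shows "linear_map K (free_space K S) V (free_lift K S V f)"
proof (rule linear_mapI)
  note simps = free_space_simps_field
  show "vectorspace K (free_space K S)" by (rule free_space_vectorspace)
  then interpret F: vectorspace K "free_space K S" .
  show "vectorspace K V" by (rule vectorspace_axioms)
  show "free_lift K S V f g \<in> carrier V" if "g \<in> carrier (free_space K S)" for g
    unfolding free_lift_def
    by (rule finsum_closed) (use f that in \<open>auto simp: simps PiE_iff Pi_iff\<close>)
  show "free_lift K S V f (g \<oplus>\<^bsub>free_space K S\<^esub> h) = free_lift K S V f g \<oplus>\<^bsub>V\<^esub> free_lift K S V f h"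
    if g: "g \<in> carrier (free_space K S)" and h: "h \<in> carrier (free_space K S)" for g h
  proof -
    define B where "B = {s \<in> S. g s \<noteq> \<zero>\<^bsub>K\<^esub>} \<union> {s \<in> S. h s \<noteq> \<zero>\<^bsub>K\<^esub>}"
    have B: "finite B" "B \<subseteq> S" "{s \<in> S. g s \<noteq> \<zero>\<^bsub>K\<^esub>} \<subseteq> B" "{s \<in> S. h s \<noteq> \<zero>\<^bsub>K\<^esub>} \<subseteq> B"
      "{s \<in> S. (g \<oplus>\<^bsub>free_space K S\<^esub> h) s \<noteq> \<zero>\<^bsub>K\<^esub>} \<subseteq> B"
      using g h by (auto simp: B_def simps)
    have gh: "g s \<in> carrier K" "h s \<in> carrier K" "f s \<in> carrier V" "s \<in> S" if "s \<in> B" for s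
      using g h f B that by (auto simp: simps PiE_iff Pi_iff)
    have "(\<Oplus>\<^bsub>V\<^esub>s\<in>B. (g \<oplus>\<^bsub>free_space K S\<^esub> h) s \<odot>\<^bsub>V\<^esub> f s) =
        (\<Oplus>\<^bsub>V\<^esub>s\<in>B. g s \<odot>\<^bsub>V\<^esub> f s \<oplus>\<^bsub>V\<^esub> h s \<odot>\<^bsub>V\<^esub> f s)"
      by (rule finsum_cong') (use gh in \<open>auto simp: simps smult_l_distr\<close>)
    also have "\<dots> = (\<Oplus>\<^bsub>V\<^esub>s\<in>B. g s \<odot>\<^bsub>V\<^esub> f s) \<oplus>\<^bsub>V\<^esub> (\<Oplus>\<^bsub>V\<^esub>s\<in>B. h s \<odot>\<^bsub>V\<^esub> f s)"
      by (rule finsum_addf) (use gh in auto)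
    finally show ?thesis
      using free_lift_eq[OF f g B(1,3,2)] free_lift_eq[OF f h B(1,4,2)]
        free_lift_eq[OF f F.a_closed[OF g h] B(1,5,2)] by simp
  qed
  show "free_lift K S V f (c \<odot>\<^bsub>free_space K S\<^esub> g) = c \<odot>\<^bsub>V\<^esub> free_lift K S V f g"
    if c: "c \<in> carrier K" and g: "g \<in> carrier (free_space K S)" for c g
  proof -
    define B where "B = {s \<in> S. g s \<noteq> \<zero>\<^bsub>K\<^esub>}"
    have B: "finite B" "B \<subseteq> S" "{s \<in> S. g s \<noteq> \<zero>\<^bsub>K\<^esub>} \<subseteq> B"
      "{s \<in> S. (c \<odot>\<^bsub>free_space K S\<^esub> g) s \<noteq> \<zero>\<^bsub>K\<^esub>} \<subseteq> B"
      using g c by (auto simp: B_def simps)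
    have gs: "g s \<in> carrier K" "f s \<in> carrier V" "s \<in> S" if "s \<in> B" for s
      using g f B that by (auto simp: simps PiE_iff Pi_iff)
    have "(\<Oplus>\<^bsub>V\<^esub>s\<in>B. (c \<odot>\<^bsub>free_space K S\<^esub> g) s \<odot>\<^bsub>V\<^esub> f s) =
        (\<Oplus>\<^bsub>V\<^esub>s\<in>B. c \<odot>\<^bsub>V\<^esub> (g s \<odot>\<^bsub>V\<^esub> f s))"
      by (rule finsum_cong') (use gs c in \<open>auto simp: simps smult_assoc1\<close>)
    also have "\<dots> = c \<odot>\<^bsub>V\<^esub> (\<Oplus>\<^bsub>V\<^esub>s\<in>B. g s \<odot>\<^bsub>V\<^esub> f s)"
      by (rule finsum_smult[symmetric]) (use gs c in auto)
    finally show ?thesis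
      using free_lift_eq[OF f g B(1,3,2)] free_lift_eq[OF f F.smult_closed[OF c g] B(1,4,2)] by simp
  qed
qed

lemma free_lift_gen:
  assumes f: "f \<in> S \<rightarrow> carrier V" and s: "s \<in> S"
  shows "free_lift K S V f (free_gen K S s) = f s"
proof -
  have "free_lift K S V f (free_gen K S s) = (\<Oplus>\<^bsub>V\<^esub>t\<in>{s}. free_gen K S s t \<odot>\<^bsub>V\<^esub> f t)"
    by (rule free_lift_eq[OF f free_gen_closed[OF s]]) (use s in \<open>auto simp: free_gen_def\<close>)
  also have "\<dots> = f s"
    using f s by (simp add: free_gen_def Pi_iff)
  finally show ?thesis .
qed

section \<open>Quotients by a subspace, and linear maps that factor through them\<close>

lemma subspace_abelian_subgroup:
  assumes "subspace K N V"
  shows "abelian_subgroup N V"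
proof -
  interpret submodule K N V using assms by (rule subspace.submod)
  have "subgroup N (add_monoid V)"
  proof
    fix x assume x: "x \<in> N"
    then have "\<ominus>\<^bsub>V\<^esub> x = (\<ominus>\<^bsub>K\<^esub> \<one>\<^bsub>K\<^esub>) \<odot>\<^bsub>V\<^esub> x" using subset by (simp add: smult_minus_1 subsetD)
    also have "\<dots> \<in> N" using x by (intro smult_closed) auto
    finally show "inv\<^bsub>add_monoid V\<^esub> x \<in> N" by (simp add: a_inv_def)
  qed (use subset in auto)
  then show ?thesis
    by (intro abelian_subgroupI3 additive_subgroupI abelian_group_axioms)
qed

text \<open>Well-definedness of the scalar action on cosets: scaling two representatives gives
  results that differ by an element of \<open>N\<close>, so every member of the union is the same
  coset. The coset contains \<open>v\<close>, so the union is not empty.\<close>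

lemma coset_smult:
  assumes N: "subspace K N V" and c: "c \<in> carrier K" and v: "v \<in> carrier V"
  shows "(\<Union>x\<in>N +>\<^bsub>V\<^esub> v. N +>\<^bsub>V\<^esub> (c \<odot>\<^bsub>V\<^esub> x)) = N +>\<^bsub>V\<^esub> (c \<odot>\<^bsub>V\<^esub> v)"
proof -
  interpret N: submodule K N V using N by (rule subspace.submod)
  interpret N: abelian_subgroup N V using N by (rule subspace_abelian_subgroup)
  have "N +>\<^bsub>V\<^esub> (c \<odot>\<^bsub>V\<^esub> x) = N +>\<^bsub>V\<^esub> (c \<odot>\<^bsub>V\<^esub> v)" if x: "x \<in> N +>\<^bsub>V\<^esub> v" for x
  proof -
    obtain n where n: "n \<in> N" "x = n \<oplus>\<^bsub>V\<^esub> v"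
      using x by (auto simp: a_r_coset_def')
    have nV: "n \<in> carrier V" using n N.subset by auto
    have "c \<odot>\<^bsub>V\<^esub> x = c \<odot>\<^bsub>V\<^esub> n \<oplus>\<^bsub>V\<^esub> c \<odot>\<^bsub>V\<^esub> v"
      using n nV c v by (simp add: smult_r_distr)
    then have "c \<odot>\<^bsub>V\<^esub> x \<in> N +>\<^bsub>V\<^esub> (c \<odot>\<^bsub>V\<^esub> v)"
      using n c by (auto simp: a_r_coset_def')
    then show ?thesis
      using N.a_repr_independence' c v by auto
  qed
  moreover have "N +>\<^bsub>V\<^esub> v \<noteq> {}"
    using N.a_rcos_self[OF v] by auto
  ultimately show ?thesis by auto
qed

lemma quotient_space_simps:
  assumes N: "subspace K N V"
  shows "carrier (quotient_space V N) = (\<lambda>v. N +>\<^bsub>V\<^esub> v) ` carrier V"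
    and "\<zero>\<^bsub>quotient_space V N\<^esub> = N +>\<^bsub>V\<^esub> \<zero>\<^bsub>V\<^esub>"
    and "v \<in> carrier V \<Longrightarrow> w \<in> carrier V \<Longrightarrow>
      (N +>\<^bsub>V\<^esub> v) \<oplus>\<^bsub>quotient_space V N\<^esub> (N +>\<^bsub>V\<^esub> w) = N +>\<^bsub>V\<^esub> (v \<oplus>\<^bsub>V\<^esub> w)"
    and "c \<in> carrier K \<Longrightarrow> v \<in> carrier V \<Longrightarrow>
      c \<odot>\<^bsub>quotient_space V N\<^esub> (N +>\<^bsub>V\<^esub> v) = N +>\<^bsub>V\<^esub> (c \<odot>\<^bsub>V\<^esub> v)"
proof -
  interpret N: submodule K N V using N by (rule subspace.submod)
  interpret N: abelian_subgroup N V using N by (rule subspace_abelian_subgroup)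
  show "carrier (quotient_space V N) = (\<lambda>v. N +>\<^bsub>V\<^esub> v) ` carrier V"
    by (auto simp: quotient_space_def A_RCOSETS_def' a_r_coset_def')
  show "\<zero>\<^bsub>quotient_space V N\<^esub> = N +>\<^bsub>V\<^esub> \<zero>\<^bsub>V\<^esub>"
    using N.subset by (simp add: quotient_space_def)
  show "v \<in> carrier V \<Longrightarrow> w \<in> carrier V \<Longrightarrow>
      (N +>\<^bsub>V\<^esub> v) \<oplus>\<^bsub>quotient_space V N\<^esub> (N +>\<^bsub>V\<^esub> w) = N +>\<^bsub>V\<^esub> (v \<oplus>\<^bsub>V\<^esub> w)"
    by (simp add: quotient_space_def N.a_rcos_sum)
  show "c \<in> carrier K \<Longrightarrow> v \<in> carrier V \<Longrightarrow>
      c \<odot>\<^bsub>quotient_space V N\<^esub> (N +>\<^bsub>V\<^esub> v) = N +>\<^bsub>V\<^esub> (c \<odot>\<^bsub>V\<^esub> v)"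
    using coset_smult[OF N] by (simp add: quotient_space_def)
qed

lemma quotient_space_vectorspace:
  assumes N: "subspace K N V"
  shows "vectorspace K (quotient_space V N)"
proof (rule vs_criteria)
  note simps = quotient_space_simps[OF N]
  show "field K" ..
  show "\<forall>v\<in>carrier (quotient_space V N). \<exists>w\<in>carrier (quotient_space V N).
      v \<oplus>\<^bsub>quotient_space V N\<^esub> w = \<zero>\<^bsub>quotient_space V N\<^esub>"
  proof
    fix X assume "X \<in> carrier (quotient_space V N)"
    then obtain x where x: "x \<in> carrier V" "X = N +>\<^bsub>V\<^esub> x"
      by (auto simp: simps)
    then have "X \<oplus>\<^bsub>quotient_space V N\<^esub> (N +>\<^bsub>V\<^esub> \<ominus>\<^bsub>V\<^esub> x) = \<zero>\<^bsub>quotient_space V N\<^esub>"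
      by (simp add: simps r_neg)
    with x show "\<exists>w\<in>carrier (quotient_space V N).
        X \<oplus>\<^bsub>quotient_space V N\<^esub> w = \<zero>\<^bsub>quotient_space V N\<^esub>"
      by (auto simp: simps(1))
  qed
qed (auto simp: quotient_space_simps[OF N] a_ac smult_assoc1 smult_l_distr smult_r_distr)

lemma quotient_map_linear:
  assumes N: "subspace K N V"
  shows "linear_map K V (quotient_space V N) (\<lambda>v. N +>\<^bsub>V\<^esub> v)"
  by (rule linear_mapI)
    (auto simp: vectorspace_axioms quotient_space_vectorspace[OF N] quotient_space_simps[OF N])

lemma quotient_map_eqD:
  assumes N: "subspace K N V" and v: "v \<in> carrier V" "w \<in> carrier V"
    and eq: "N +>\<^bsub>V\<^esub> v = N +>\<^bsub>V\<^esub> w"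
  shows "v \<ominus>\<^bsub>V\<^esub> w \<in> N"
proof -
  interpret N: abelian_subgroup N V using N by (rule subspace_abelian_subgroup)
  have "v \<in> N +>\<^bsub>V\<^esub> w" using N.a_rcos_self[OF v(1)] eq by simp
  with v show ?thesis by (simp add: N.a_rcos_module a_minus_def)
qed

lemma quotient_map_eqI:
  assumes N: "subspace K N V" and v: "v \<in> carrier V" "w \<in> carrier V"
    and diff: "v \<ominus>\<^bsub>V\<^esub> w \<in> N"
  shows "N +>\<^bsub>V\<^esub> v = N +>\<^bsub>V\<^esub> w"
proof -
  interpret N: abelian_subgroup N V using N by (rule subspace_abelian_subgroup)
  have "v \<in> N +>\<^bsub>V\<^esub> w" using v diff by (simp add: N.a_rcos_module a_minus_def)
  then show ?thesis using N.a_repr_independence' v by auto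
qed

end

lemma linear_map_factor:
  assumes N: "subspace K N V" and f: "linear_map K V W f"
    and kills: "\<And>n. n \<in> N \<Longrightarrow> f n = \<zero>\<^bsub>W\<^esub>"
  obtains g where "linear_map K (quotient_space V N) W g"
    "\<And>v. v \<in> carrier V \<Longrightarrow> g (N +>\<^bsub>V\<^esub> v) = f v"
proof -
  interpret f: linear_map K V W f by fact
  have W: "abelian_group W"
    using f.W.vectorspace_axioms by (simp add: vectorspace_def module_def)
  \<comment> \<open>A value is read off at an arbitrary representative. Two representatives differ
    by an element of \<open>N\<close>, which \<open>f\<close> kills, so the choice does not
    matter.\<close>
  define g where "g X = f (SOME v. v \<in> carrier V \<and> X = N +>\<^bsub>V\<^esub> v)" for X
  have g: "g (N +>\<^bsub>V\<^esub> v) = f v" if v: "v \<in> carrier V" for v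
  proof -
    define w where "w = (SOME w. w \<in> carrier V \<and> N +>\<^bsub>V\<^esub> v = N +>\<^bsub>V\<^esub> w)"
    have "w \<in> carrier V \<and> N +>\<^bsub>V\<^esub> v = N +>\<^bsub>V\<^esub> w"
      unfolding w_def by (rule someI[of _ v]) (simp add: v)
    then have w: "w \<in> carrier V" and "v \<ominus>\<^bsub>V\<^esub> w \<in> N"
      using f.V.quotient_map_eqD[OF N v] by auto
    then have "f v \<ominus>\<^bsub>W\<^esub> f w = \<zero>\<^bsub>W\<^esub>"
      using kills v by (metis f.f_minus)
    then have "f v = f w"
      using abelian_group.minus_eq_zero_iff[OF W] v w by (metis f.f_im)
    then show ?thesis by (simp add: g_def w_def)
  qed
  have "linear_map K (quotient_space V N) W g"
    by (rule linear_mapI)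
      (auto simp: f.V.quotient_space_vectorspace[OF N] f.W.vectorspace_axioms
        f.V.quotient_space_simps[OF N] g)
  then show thesis using g by (rule that)
qed

section \<open>The universal property of the tensor product\<close>

definition bilinear_on ::
    "('k, 'r) ring_scheme \<Rightarrow> ('k, 'v, 'm) module_scheme \<Rightarrow> ('k, 'w, 'n) module_scheme
      \<Rightarrow> ('k, 'u, 'l) module_scheme \<Rightarrow> ('v \<Rightarrow> 'w \<Rightarrow> 'u) \<Rightarrow> bool" where
  "bilinear_on K V W U f \<longleftrightarrow>
     (\<forall>v\<in>carrier V. linear_map K W U (f v)) \<and> (\<forall>w\<in>carrier W. linear_map K V U (\<lambda>v. f v w))"

lemma bilinear_onD:
  assumes "bilinear_on K V W U f"
  shows "v \<in> carrier V \<Longrightarrow> linear_map K W U (f v)"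
    and "w \<in> carrier W \<Longrightarrow> linear_map K V U (\<lambda>v. f v w)"
  using assms by (simp_all add: bilinear_on_def)

lemma linear_map_cong:
  assumes "linear_map K V W f" and "\<And>v. v \<in> carrier V \<Longrightarrow> f v = g v"
  shows "linear_map K V W g"
proof -
  interpret f: linear_map K V W f by fact
  show ?thesis
    by (rule linear_mapI)
      (simp_all add: f.V.vectorspace_axioms f.W.vectorspace_axioms flip: assms(2))
qed

lemma bilinear_on_compose:
  assumes f: "bilinear_on K V W U f" and g: "linear_map K U X g"
  shows "bilinear_on K V W X (\<lambda>v w. g (f v w))"
  using f by (auto simp: bilinear_on_def dest: linear_map_comp[OF _ g, unfolded comp_def])

lemma bilinear_on_precompose:
  assumes f: "bilinear_on K V W U f" and g: "linear_map K V' V g" and h: "linear_map K W' W h"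
  shows "bilinear_on K V' W' U (\<lambda>v w. f (g v) (h w))"
  unfolding bilinear_on_def
proof (intro conjI ballI)
  fix v assume "v \<in> carrier V'"
  then have "linear_map K W U (f (g v))"
    using f linear_mapD(3)[OF g] by (simp add: bilinear_on_def)
  from linear_map_comp[OF h this] show "linear_map K W' U (\<lambda>w. f (g v) (h w))"
    by (simp add: comp_def)
next
  fix w assume "w \<in> carrier W'"
  then have "linear_map K V U (\<lambda>v. f v (h w))"
    using f linear_mapD(3)[OF h] by (simp add: bilinear_on_def)
  from linear_map_comp[OF g this] show "linear_map K V' U (\<lambda>v. f (g v) (h w))"
    by (simp add: comp_def)
qed

lemma linear_map_id: "vectorspace K V \<Longrightarrow> linear_map K V V id"
  by (rule linear_mapI) simp_all

section \<open>Linear combinations of linear and of bilinear maps\<close>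

lemma (in vectorspace) linear_map_add:
  assumes f: "linear_map K U V f" and g: "linear_map K U V g"
  shows "linear_map K U V (\<lambda>x. f x \<oplus>\<^bsub>V\<^esub> g x)"
  by (rule linear_mapI)
    (simp_all add: linear_mapD[OF f] linear_mapD[OF g] smult_r_distr a_ac)

lemma (in vectorspace) linear_map_smult:
  assumes f: "linear_map K U V f" and c: "c \<in> carrier K"
  shows "linear_map K U V (\<lambda>x. c \<odot>\<^bsub>V\<^esub> f x)"
proof (rule linear_mapI)
  fix d v assume d: "d \<in> carrier K" and v: "v \<in> carrier U"
  have "c \<odot>\<^bsub>V\<^esub> f (d \<odot>\<^bsub>U\<^esub> v) = (c \<otimes>\<^bsub>K\<^esub> d) \<odot>\<^bsub>V\<^esub> f v"
    using c d v by (simp add: linear_mapD[OF f] smult_assoc1)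
  also have "\<dots> = (d \<otimes>\<^bsub>K\<^esub> c) \<odot>\<^bsub>V\<^esub> f v"
    using c d by (simp add: m_comm)
  also have "\<dots> = d \<odot>\<^bsub>V\<^esub> (c \<odot>\<^bsub>V\<^esub> f v)"
    using c d v by (simp add: linear_mapD[OF f] smult_assoc1)
  finally show "c \<odot>\<^bsub>V\<^esub> f (d \<odot>\<^bsub>U\<^esub> v) = d \<odot>\<^bsub>V\<^esub> (c \<odot>\<^bsub>V\<^esub> f v)" .
qed (use c in \<open>simp_all add: linear_mapD[OF f] smult_r_distr vectorspace_axioms\<close>)

lemma (in vectorspace) linear_map_diff:
  assumes f: "linear_map K U V f" and g: "linear_map K U V g"
  shows "linear_map K U V (\<lambda>x. f x \<ominus>\<^bsub>V\<^esub> g x)"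
proof -
  have "linear_map K U V (\<lambda>x. f x \<oplus>\<^bsub>V\<^esub> (\<ominus>\<^bsub>K\<^esub> \<one>\<^bsub>K\<^esub>) \<odot>\<^bsub>V\<^esub> g x)"
    by (intro linear_map_add f linear_map_smult g) simp
  then show ?thesis
    by (rule linear_map_cong) (simp add: linear_mapD[OF g] smult_minus_1 a_minus_def)
qed

lemma (in vectorspace) linear_map_zero:
  "vectorspace K U \<Longrightarrow> linear_map K U V (\<lambda>_. \<zero>\<^bsub>V\<^esub>)"
  by (rule linear_mapI) (simp_all add: vectorspace_axioms)

lemma (in vectorspace) bilinear_on_add:
  assumes "bilinear_on K X Y V f" "bilinear_on K X Y V g"
  shows "bilinear_on K X Y V (\<lambda>x y. f x y \<oplus>\<^bsub>V\<^esub> g x y)"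
  using assms by (simp add: bilinear_on_def linear_map_add)

lemma (in vectorspace) bilinear_on_smult:
  assumes "bilinear_on K X Y V f" "c \<in> carrier K"
  shows "bilinear_on K X Y V (\<lambda>x y. c \<odot>\<^bsub>V\<^esub> f x y)"
  using assms by (simp add: bilinear_on_def linear_map_smult)

lemma (in vectorspace) bilinear_on_diff:
  assumes "bilinear_on K X Y V f" "bilinear_on K X Y V g"
  shows "bilinear_on K X Y V (\<lambda>x y. f x y \<ominus>\<^bsub>V\<^esub> g x y)"
  using assms by (simp add: bilinear_on_def linear_map_diff)

section \<open>Pure tensors, their relations, and induced maps on a twofold tensor product\<close>

locale vectorspace_pair = V: vectorspace K V + W: vectorspace K W for K and V and W
begin

abbreviation F where "F \<equiv> free_space K (carrier V \<times> carrier W)"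
abbreviation \<delta> where "\<delta> v w \<equiv> free_gen K (carrier V \<times> carrier W) (v, w)"
abbreviation T where "T \<equiv> tensor K V W"
abbreviation pt (infixl \<open>\<otimes>\<^sub>t\<close> 70) where "v \<otimes>\<^sub>t w \<equiv> pure_tensor K V W v w"

sublocale F: vectorspace K F
  by (rule V.free_space_vectorspace)

lemma gen_closed [simp]: "v \<in> carrier V \<Longrightarrow> w \<in> carrier W \<Longrightarrow> \<delta> v w \<in> carrier F"
  by (rule V.free_gen_closed) simp

lemma tensor_relations_subset: "tensor_relations K V W \<subseteq> carrier F"
  unfolding tensor_relations_def Let_def by (auto intro!: F.minus_closed)

lemma tensor_kernel_subspace: "subspace K (tensor_kernel K V W) F"
  unfolding tensor_kernel_def by (rule F.span_is_subspace[OF tensor_relations_subset])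

lemma tensor_relations_subset_kernel: "tensor_relations K V W \<subseteq> tensor_kernel K V W"
  unfolding tensor_kernel_def by (rule F.in_own_span[OF tensor_relations_subset])

sublocale T: vectorspace K T
  unfolding tensor_def by (rule F.quotient_space_vectorspace[OF tensor_kernel_subspace])

lemma tensor_quotient_map_linear:
  "linear_map K F T (\<lambda>x. tensor_kernel K V W +>\<^bsub>F\<^esub> x)"
  unfolding tensor_def by (rule F.quotient_map_linear[OF tensor_kernel_subspace])

lemma pure_tensor_closed [simp]:
  "v \<in> carrier V \<Longrightarrow> w \<in> carrier W \<Longrightarrow> v \<otimes>\<^sub>t w \<in> carrier T"
  unfolding pure_tensor_def by (rule linear_mapD(3)[OF tensor_quotient_map_linear]) simp

lemma tensor_relation_quotient:
  assumes "x \<in> carrier F" "y \<in> carrier F" "x \<ominus>\<^bsub>F\<^esub> y \<in> tensor_relations K V W"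
  shows "tensor_kernel K V W +>\<^bsub>F\<^esub> x = tensor_kernel K V W +>\<^bsub>F\<^esub> y"
  using assms tensor_relations_subset_kernel
  by (intro F.quotient_map_eqI[OF tensor_kernel_subspace]) auto

text \<open>Each of the four linearity laws is one of the four families in
  \<open>tensor_relations\<close>, transported to the quotient.\<close>

lemma pure_tensor_bilinear: "bilinear_on K V W T (pure_tensor K V W)"
  unfolding bilinear_on_def
proof (intro conjI ballI linear_mapI)
  note lin = linear_mapD(4,5)[OF tensor_quotient_map_linear, symmetric]
  show "vectorspace K W" "vectorspace K T" "vectorspace K V" "vectorspace K T"
    by (rule W.vectorspace_axioms T.vectorspace_axioms V.vectorspace_axioms)+
  fix v w assume v: "v \<in> carrier V" and w: "w \<in> carrier W"
  then show "v \<otimes>\<^sub>t w \<in> carrier T" "v \<otimes>\<^sub>t w \<in> carrier T" by simp_all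
  show "v \<otimes>\<^sub>t (w \<oplus>\<^bsub>W\<^esub> w') = v \<otimes>\<^sub>t w \<oplus>\<^bsub>T\<^esub> v \<otimes>\<^sub>t w'" if w': "w' \<in> carrier W" for w'
  proof -
    have "\<delta> v (w \<oplus>\<^bsub>W\<^esub> w') \<ominus>\<^bsub>F\<^esub> (\<delta> v w \<oplus>\<^bsub>F\<^esub> \<delta> v w') \<in> tensor_relations K V W"
      unfolding tensor_relations_def Let_def using v w w' by blast
    from tensor_relation_quotient[OF _ _ this] show ?thesis
      using v w w' by (simp add: pure_tensor_def lin)
  qed
  show "(v \<oplus>\<^bsub>V\<^esub> v') \<otimes>\<^sub>t w = v \<otimes>\<^sub>t w \<oplus>\<^bsub>T\<^esub> v' \<otimes>\<^sub>t w" if v': "v' \<in> carrier V" for v'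
  proof -
    have "\<delta> (v \<oplus>\<^bsub>V\<^esub> v') w \<ominus>\<^bsub>F\<^esub> (\<delta> v w \<oplus>\<^bsub>F\<^esub> \<delta> v' w) \<in> tensor_relations K V W"
      unfolding tensor_relations_def Let_def using v w v' by blast
    from tensor_relation_quotient[OF _ _ this] show ?thesis
      using v w v' by (simp add: pure_tensor_def lin)
  qed
  show "v \<otimes>\<^sub>t (c \<odot>\<^bsub>W\<^esub> w) = c \<odot>\<^bsub>T\<^esub> (v \<otimes>\<^sub>t w)" if c: "c \<in> carrier K" for c
  proof -
    have "\<delta> v (c \<odot>\<^bsub>W\<^esub> w) \<ominus>\<^bsub>F\<^esub> (c \<odot>\<^bsub>F\<^esub> \<delta> v w) \<in> tensor_relations K V W"
      unfolding tensor_relations_def Let_def using v w c by blast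
    from tensor_relation_quotient[OF _ _ this] show ?thesis
      using v w c by (simp add: pure_tensor_def lin)
  qed
  show "(c \<odot>\<^bsub>V\<^esub> v) \<otimes>\<^sub>t w = c \<odot>\<^bsub>T\<^esub> (v \<otimes>\<^sub>t w)" if c: "c \<in> carrier K" for c
  proof -
    have "\<delta> (c \<odot>\<^bsub>V\<^esub> v) w \<ominus>\<^bsub>F\<^esub> (c \<odot>\<^bsub>F\<^esub> \<delta> v w) \<in> tensor_relations K V W"
      unfolding tensor_relations_def Let_def using v w c by blast
    from tensor_relation_quotient[OF _ _ this] show ?thesis
      using v w c by (simp add: pure_tensor_def lin)
  qed
qed

text \<open>This descends from \<open>free_space_induct\<close> along the quotient map. No scalar
  appears in the \<open>add\<close> case because it is absorbed into the first factor by
  bilinearity.\<close>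

lemma tensor_induct [consumes 1, case_names zero add]:
  assumes x: "x \<in> carrier T"
    and zero: "P \<zero>\<^bsub>T\<^esub>"
    and add: "\<And>v w y. \<lbrakk>v \<in> carrier V; w \<in> carrier W; y \<in> carrier T; P y\<rbrakk> \<Longrightarrow> P (v \<otimes>\<^sub>t w \<oplus>\<^bsub>T\<^esub> y)"
  shows "P x"
proof -
  let ?q = "\<lambda>x. tensor_kernel K V W +>\<^bsub>F\<^esub> x"
  note q = linear_mapD[OF tensor_quotient_map_linear]
  obtain f where f: "f \<in> carrier F" "x = ?q f"
    using x F.quotient_space_simps(1)[OF tensor_kernel_subspace] by (auto simp: tensor_def)
  have "P (?q f)" using f(1)
  proof (induction f rule: V.free_space_induct)
    case zero
    show ?case using \<open>P \<zero>\<^bsub>T\<^esub>\<close> by (simp add: q(7))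
  next
    case (add c s g)
    obtain v w where s: "s = (v, w)" "v \<in> carrier V" "w \<in> carrier W" using add(2) by auto
    have "?q (c \<odot>\<^bsub>F\<^esub> \<delta> v w \<oplus>\<^bsub>F\<^esub> g) = c \<odot>\<^bsub>T\<^esub> (v \<otimes>\<^sub>t w) \<oplus>\<^bsub>T\<^esub> ?q g"
      using s add by (simp add: q pure_tensor_def)
    also have "c \<odot>\<^bsub>T\<^esub> (v \<otimes>\<^sub>t w) = (c \<odot>\<^bsub>V\<^esub> v) \<otimes>\<^sub>t w"
      using linear_mapD(5)[OF bilinear_onD(2)[OF pure_tensor_bilinear s(3)] add(1) s(2)] by simp
    finally show ?case
      using assms(3)[of "c \<odot>\<^bsub>V\<^esub> v" w "?q g"] add s q(3) by simp
  qed
  with f show ?thesis by simp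
qed

lemma tensor_linear_map_eqI:
  assumes f: "linear_map K T U f" and g: "linear_map K T U g"
    and eq: "\<And>v w. v \<in> carrier V \<Longrightarrow> w \<in> carrier W \<Longrightarrow> f (v \<otimes>\<^sub>t w) = g (v \<otimes>\<^sub>t w)"
    and x: "x \<in> carrier T"
  shows "f x = g x"
  using x
proof (induction x rule: tensor_induct)
  case zero
  show ?case by (simp add: linear_mapD(7)[OF f] linear_mapD(7)[OF g])
next
  case (add v w y)
  then show ?case by (simp add: linear_mapD(4)[OF f] linear_mapD(4)[OF g] eq)
qed

text \<open>The linear extension of \<open>f\<close> to the free space sends each relation to zero
  by bilinearity. Its kernel is a submodule, so it contains the span of the relations, and the
  extension factors through the quotient.\<close>

lemma tensor_induced_exists:
  assumes f: "bilinear_on K V W U f" and U: "vectorspace K U"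
  shows "\<exists>g. tensor_induced K V W U f g"
proof -
  interpret U: vectorspace K U by fact
  note fl = linear_mapD[OF bilinear_onD(1)[OF f]] and fr = linear_mapD[OF bilinear_onD(2)[OF f]]
  let ?S = "carrier V \<times> carrier W"
  let ?f = "free_lift K ?S U (\<lambda>(v, w). f v w)"
  have fS: "(\<lambda>(v, w). f v w) \<in> ?S \<rightarrow> carrier U"
    using fl(3) by auto
  have lin: "linear_map K F U ?f"
    by (rule U.free_lift_linear[OF fS])
  interpret L: linear_map K F U ?f by (rule lin)
  have gen: "?f (\<delta> v w) = f v w" if "v \<in> carrier V" "w \<in> carrier W" for v w
    using U.free_lift_gen[OF fS, of "(v, w)"] that by simp
  have "tensor_relations K V W \<subseteq> L.ker"
    unfolding tensor_relations_def Let_def L.ker_def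
    by (auto simp: gen fl fr U.minus_eq_zero_iff)
  then have "tensor_kernel K V W \<subseteq> L.ker"
    unfolding tensor_kernel_def by (rule F.span_is_subset[OF _ L.ker_is_submodule])
  then have "\<And>n. n \<in> tensor_kernel K V W \<Longrightarrow> ?f n = \<zero>\<^bsub>U\<^esub>"
    by (auto simp: L.ker_def)
  then obtain g where "linear_map K T U g"
    "\<And>x. x \<in> carrier F \<Longrightarrow> g (tensor_kernel K V W +>\<^bsub>F\<^esub> x) = ?f x"
    using linear_map_factor[OF tensor_kernel_subspace lin] unfolding tensor_def by blast
  then show ?thesis
    by (auto simp: tensor_induced_def pure_tensor_def gen)
qed

text \<open>Restricting any induced map to the carrier makes it extensional. Two extensional
  candidates agree on the carrier because they agree on pure tensors, and off the carrier by
  extensionality; so \<open>THE\<close> has a unique witness.\<close>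

lemma tensor_lift_induced:
  assumes f: "bilinear_on K V W U f" and U: "vectorspace K U"
  shows "tensor_induced K V W U f (tensor_lift K V W U f)"
proof -
  obtain g where g: "tensor_induced K V W U f g"
    using tensor_induced_exists[OF assms] by blast
  let ?g = "restrict g (carrier T)"
  have "\<exists>!g. g \<in> extensional (carrier T) \<and> tensor_induced K V W U f g"
  proof (rule ex1I)
    show "?g \<in> extensional (carrier T) \<and> tensor_induced K V W U f ?g"
      using g linear_map_cong[of K T U g ?g] by (simp add: tensor_induced_def)
    show "h = ?g" if h: "h \<in> extensional (carrier T) \<and> tensor_induced K V W U f h" for h
    proof (rule extensionalityI[of _ "carrier T"])
      show "h x = ?g x" if "x \<in> carrier T" for x
        using that h g tensor_linear_map_eqI[of U h g x] by (simp add: tensor_induced_def)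
    qed (use h in auto)
  qed
  then show ?thesis
    unfolding tensor_lift_def by (rule theI'[THEN conjunct2])
qed

lemma tensor_lift_linear:
  assumes "bilinear_on K V W U f" "vectorspace K U"
  shows "linear_map K T U (tensor_lift K V W U f)"
  using tensor_lift_induced[OF assms] by (simp add: tensor_induced_def)

lemma tensor_lift_pure:
  assumes "bilinear_on K V W U f" "vectorspace K U" "v \<in> carrier V" "w \<in> carrier W"
  shows "tensor_lift K V W U f (v \<otimes>\<^sub>t w) = f v w"
  using tensor_lift_induced[OF assms(1,2)] assms(3,4) by (simp add: tensor_induced_def)

end

section \<open>Threefold tensor products\<close>

text \<open>A nested lift is lifted again in its outer variable, so it must be linear in the
  parameter \<open>p\<close> as well as in \<open>x\<close>. Induction on \<open>x\<close> reduces
  this to linearity of \<open>h\<close> in \<open>p\<close> at pure tensors.\<close>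

lemma (in vectorspace_pair) tensor_lift_linear_param:
  assumes bilin: "\<And>p. p \<in> carrier P \<Longrightarrow> bilinear_on K V W U (h p)"
    and lin: "\<And>v w. v \<in> carrier V \<Longrightarrow> w \<in> carrier W \<Longrightarrow> linear_map K P U (\<lambda>p. h p v w)"
    and P: "vectorspace K P" and U: "vectorspace K U" and x: "x \<in> carrier T"
  shows "linear_map K P U (\<lambda>p. tensor_lift K V W U (h p) x)"
  using x
proof (induction x rule: tensor_induct)
  interpret U: vectorspace K U by fact
  note lift = linear_mapD[OF tensor_lift_linear[OF bilin U]]
  case zero
  show ?case
    by (rule linear_map_cong[OF U.linear_map_zero[OF P]]) (simp add: lift)
next
  interpret U: vectorspace K U by fact
  note lift = linear_mapD[OF tensor_lift_linear[OF bilin U]]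
  case (add v w y)
  show ?case
    by (rule linear_map_cong[OF U.linear_map_add[OF lin[OF add(1,2)] add(4)]])
      (use add in \<open>simp add: lift tensor_lift_pure[OF bilin U]\<close>)
qed

lemma (in vectorspace_pair) tensor_map_linear:
  assumes f: "linear_map K V V' f" and g: "linear_map K W W' g"
  shows "linear_map K T (tensor K V' W') (tensor_map K V W V' W' f g)"
    and "v \<in> carrier V \<Longrightarrow> w \<in> carrier W \<Longrightarrow>
      tensor_map K V W V' W' f g (v \<otimes>\<^sub>t w) = pure_tensor K V' W' (f v) (g w)"
proof -
  interpret T': vectorspace_pair K V' W'
    using linear_mapD(2)[OF f] linear_mapD(2)[OF g] by (simp add: vectorspace_pair_def)
  note bilin = bilinear_on_precompose[OF T'.pure_tensor_bilinear f g]
  show "linear_map K T (tensor K V' W') (tensor_map K V W V' W' f g)"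
    unfolding tensor_map_def by (rule tensor_lift_linear[OF bilin T'.T.vectorspace_axioms])
  show "v \<in> carrier V \<Longrightarrow> w \<in> carrier W \<Longrightarrow>
      tensor_map K V W V' W' f g (v \<otimes>\<^sub>t w) = pure_tensor K V' W' (f v) (g w)"
    unfolding tensor_map_def by (rule tensor_lift_pure[OF bilin T'.T.vectorspace_axioms])
qed

locale vectorspace_triple =
  U: vectorspace K U + V: vectorspace K V + W: vectorspace K W for K and U and V and W
begin

sublocale UV: vectorspace_pair K U V ..
sublocale VW: vectorspace_pair K V W ..
sublocale UW: vectorspace_pair K U W ..
sublocale U_VW: vectorspace_pair K U "tensor K V W" ..
sublocale UV_W: vectorspace_pair K "tensor K U V" W ..

abbreviation pt3 where "pt3 \<equiv> pure_tensor3 K U V W"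

lemma tensor3_vectorspace: "vectorspace K (tensor3 K U V W)"
  unfolding tensor3_def by (rule UV_W.T.vectorspace_axioms)

lemma pure_tensor3_closed [simp]:
  "\<lbrakk>u \<in> carrier U; v \<in> carrier V; w \<in> carrier W\<rbrakk> \<Longrightarrow> pt3 u v w \<in> carrier (tensor3 K U V W)"
  by (simp add: tensor3_def pure_tensor3_def)

lemma pure_tensor3_linear:
  shows "v \<in> carrier V \<Longrightarrow> w \<in> carrier W \<Longrightarrow> linear_map K U (tensor3 K U V W) (\<lambda>u. pt3 u v w)"
    and "u \<in> carrier U \<Longrightarrow> w \<in> carrier W \<Longrightarrow> linear_map K V (tensor3 K U V W) (\<lambda>v. pt3 u v w)"
    and "u \<in> carrier U \<Longrightarrow> v \<in> carrier V \<Longrightarrow> linear_map K W (tensor3 K U V W) (\<lambda>w. pt3 u v w)"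
  using linear_map_comp[OF bilinear_onD(2)[OF UV.pure_tensor_bilinear]
      bilinear_onD(2)[OF UV_W.pure_tensor_bilinear]]
    linear_map_comp[OF bilinear_onD(1)[OF UV.pure_tensor_bilinear]
      bilinear_onD(2)[OF UV_W.pure_tensor_bilinear]]
    bilinear_onD(1)[OF UV_W.pure_tensor_bilinear]
  by (simp_all add: tensor3_def pure_tensor3_def comp_def)

text \<open>A pure tensor of \<open>(U \<otimes> V) \<otimes> W\<close> has an arbitrary first entry
  \<open>y\<close>. With \<open>w\<close> fixed, both sides are linear in \<open>y\<close>, so
  uniqueness is applied a second time on \<open>U \<otimes> V\<close>.\<close>

lemma tensor3_linear_map_eqI:
  assumes f: "linear_map K (tensor3 K U V W) X f" and g: "linear_map K (tensor3 K U V W) X g"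
    and eq: "\<And>u v w. \<lbrakk>u \<in> carrier U; v \<in> carrier V; w \<in> carrier W\<rbrakk> \<Longrightarrow> f (pt3 u v w) = g (pt3 u v w)"
    and x: "x \<in> carrier (tensor3 K U V W)"
  shows "f x = g x"
proof (rule UV_W.tensor_linear_map_eqI[OF _ _ _ x[unfolded tensor3_def]])
  show f': "linear_map K (tensor K (tensor K U V) W) X f"
    and g': "linear_map K (tensor K (tensor K U V) W) X g"
    using f g by (simp_all add: tensor3_def)
  fix y w assume y: "y \<in> carrier (tensor K U V)" and w: "w \<in> carrier W"
  note lin = bilinear_onD(2)[OF UV_W.pure_tensor_bilinear w]
  have "(f \<circ> (\<lambda>y. pure_tensor K (tensor K U V) W y w)) y =
      (g \<circ> (\<lambda>y. pure_tensor K (tensor K U V) W y w)) y"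
    by (rule UV.tensor_linear_map_eqI[OF linear_map_comp[OF lin f'] linear_map_comp[OF lin g'] _ y])
      (use eq w in \<open>simp add: pure_tensor3_def\<close>)
  then show "f (pure_tensor K (tensor K U V) W y w) = g (pure_tensor K (tensor K U V) W y w)"
    by simp
qed

text \<open>The universal property for trilinear \<open>h\<close>, in the nested form of
  \<open>tensor_assoc\<close> and \<open>tensor_swap23\<close>; \<open>nested_lift_right\<close> is
  the counterpart for \<open>tensor_assoc_inv\<close>.\<close>

lemma nested_lift_left:
  assumes X: "vectorspace K X"
    and lin: "\<And>v w. v \<in> carrier V \<Longrightarrow> w \<in> carrier W \<Longrightarrow> linear_map K U X (\<lambda>u. h u v w)"
      "\<And>u w. u \<in> carrier U \<Longrightarrow> w \<in> carrier W \<Longrightarrow> linear_map K V X (\<lambda>v. h u v w)"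
      "\<And>u v. u \<in> carrier U \<Longrightarrow> v \<in> carrier V \<Longrightarrow> linear_map K W X (\<lambda>w. h u v w)"
  defines "f \<equiv> tensor_lift K (tensor K U V) W X (\<lambda>x w. tensor_lift K U V X (\<lambda>u v. h u v w) x)"
  shows "linear_map K (tensor3 K U V W) X f"
    and "\<lbrakk>u \<in> carrier U; v \<in> carrier V; w \<in> carrier W\<rbrakk> \<Longrightarrow> f (pt3 u v w) = h u v w"
proof -
  have h: "bilinear_on K U V X (\<lambda>u v. h u v w)" if "w \<in> carrier W" for w
    using lin that by (simp add: bilinear_on_def)
  have bilin: "bilinear_on K (tensor K U V) W X (\<lambda>x w. tensor_lift K U V X (\<lambda>u v. h u v w) x)"
    unfolding bilinear_on_def
    using UV.tensor_lift_linear[OF h X]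
      UV.tensor_lift_linear_param[OF h lin(3) W.vectorspace_axioms X] by simp
  show "linear_map K (tensor3 K U V W) X f"
    unfolding f_def tensor3_def by (rule UV_W.tensor_lift_linear[OF bilin X])
  show "\<lbrakk>u \<in> carrier U; v \<in> carrier V; w \<in> carrier W\<rbrakk> \<Longrightarrow> f (pt3 u v w) = h u v w"
    unfolding f_def pure_tensor3_def
    by (simp add: UV_W.tensor_lift_pure[OF bilin X] UV.tensor_lift_pure[OF h X])
qed

lemma nested_lift_right:
  assumes X: "vectorspace K X"
    and lin: "\<And>v w. v \<in> carrier V \<Longrightarrow> w \<in> carrier W \<Longrightarrow> linear_map K U X (\<lambda>u. h u v w)"
      "\<And>u w. u \<in> carrier U \<Longrightarrow> w \<in> carrier W \<Longrightarrow> linear_map K V X (\<lambda>v. h u v w)"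
      "\<And>u v. u \<in> carrier U \<Longrightarrow> v \<in> carrier V \<Longrightarrow> linear_map K W X (\<lambda>w. h u v w)"
  defines "f \<equiv> tensor_lift K U (tensor K V W) X (\<lambda>u. tensor_lift K V W X (h u))"
  shows "linear_map K (tensor K U (tensor K V W)) X f"
    and "\<lbrakk>u \<in> carrier U; v \<in> carrier V; w \<in> carrier W\<rbrakk> \<Longrightarrow>
      f (pure_tensor K U (tensor K V W) u (pure_tensor K V W v w)) = h u v w"
proof -
  have h: "bilinear_on K V W X (h u)" if "u \<in> carrier U" for u
    using lin that by (simp add: bilinear_on_def)
  have bilin: "bilinear_on K U (tensor K V W) X (\<lambda>u. tensor_lift K V W X (h u))"
    unfolding bilinear_on_def
    using VW.tensor_lift_linear[OF h X]
      VW.tensor_lift_linear_param[OF h lin(1) U.vectorspace_axioms X] by simp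
  show "linear_map K (tensor K U (tensor K V W)) X f"
    unfolding f_def by (rule U_VW.tensor_lift_linear[OF bilin X])
  show "\<lbrakk>u \<in> carrier U; v \<in> carrier V; w \<in> carrier W\<rbrakk> \<Longrightarrow>
      f (pure_tensor K U (tensor K V W) u (pure_tensor K V W v w)) = h u v w"
    unfolding f_def
    by (simp add: U_VW.tensor_lift_pure[OF bilin X] VW.tensor_lift_pure[OF h X])
qed

lemma tensor_assoc_linear:
  shows "linear_map K (tensor3 K U V W) (tensor K U (tensor K V W)) (tensor_assoc K U V W)"
    and "\<lbrakk>u \<in> carrier U; v \<in> carrier V; w \<in> carrier W\<rbrakk> \<Longrightarrow>
      tensor_assoc K U V W (pt3 u v w) = pure_tensor K U (tensor K V W) u (pure_tensor K V W v w)"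
proof -
  let ?h = "\<lambda>u v w. pure_tensor K U (tensor K V W) u (pure_tensor K V W v w)"
  let ?X = "tensor K U (tensor K V W)"
  have lin: "\<And>v w. v \<in> carrier V \<Longrightarrow> w \<in> carrier W \<Longrightarrow> linear_map K U ?X (\<lambda>u. ?h u v w)"
      "\<And>u w. u \<in> carrier U \<Longrightarrow> w \<in> carrier W \<Longrightarrow> linear_map K V ?X (\<lambda>v. ?h u v w)"
      "\<And>u v. u \<in> carrier U \<Longrightarrow> v \<in> carrier V \<Longrightarrow> linear_map K W ?X (\<lambda>w. ?h u v w)"
    using bilinear_onD(2)[OF U_VW.pure_tensor_bilinear]
      linear_map_comp[OF bilinear_onD(2)[OF VW.pure_tensor_bilinear]
        bilinear_onD(1)[OF U_VW.pure_tensor_bilinear]]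
      linear_map_comp[OF bilinear_onD(1)[OF VW.pure_tensor_bilinear]
        bilinear_onD(1)[OF U_VW.pure_tensor_bilinear]]
    by (simp_all add: comp_def)
  show "linear_map K (tensor3 K U V W) ?X (tensor_assoc K U V W)"
    and "\<lbrakk>u \<in> carrier U; v \<in> carrier V; w \<in> carrier W\<rbrakk> \<Longrightarrow>
      tensor_assoc K U V W (pt3 u v w) = pure_tensor K U (tensor K V W) u (pure_tensor K V W v w)"
    unfolding tensor_assoc_def Let_def
    using nested_lift_left[of ?X ?h, OF U_VW.T.vectorspace_axioms lin] by simp_all
qed

lemma tensor_assoc_inv_linear:
  shows "linear_map K (tensor K U (tensor K V W)) (tensor3 K U V W) (tensor_assoc_inv K U V W)"
    and "\<lbrakk>u \<in> carrier U; v \<in> carrier V; w \<in> carrier W\<rbrakk> \<Longrightarrow>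
      tensor_assoc_inv K U V W (pure_tensor K U (tensor K V W) u (pure_tensor K V W v w)) = pt3 u v w"
  unfolding tensor_assoc_inv_def Let_def
  using nested_lift_right[of "tensor3 K U V W" pt3, OF tensor3_vectorspace pure_tensor3_linear]
  by simp_all

lemma tensor_swap23_linear:
  shows "linear_map K (tensor3 K U V W) (tensor3 K U W V) (tensor_swap23 K U V W)"
    and "\<lbrakk>u \<in> carrier U; v \<in> carrier V; w \<in> carrier W\<rbrakk> \<Longrightarrow>
      tensor_swap23 K U V W (pt3 u v w) = pure_tensor3 K U W V u w v"
proof -
  interpret swapped: vectorspace_triple K U W V ..
  show "linear_map K (tensor3 K U V W) (tensor3 K U W V) (tensor_swap23 K U V W)"
    and "\<lbrakk>u \<in> carrier U; v \<in> carrier V; w \<in> carrier W\<rbrakk> \<Longrightarrow>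
      tensor_swap23 K U V W (pt3 u v w) = pure_tensor3 K U W V u w v"
    unfolding tensor_swap23_def Let_def
    \<comment> \<open>In the swapped triple the second slot is \<open>W\<close> and the third is
      \<open>V\<close>, hence the order \<open>(1,3,2)\<close> of the linearity facts.\<close>
    using nested_lift_left[of "tensor3 K U W V" "\<lambda>u v w. pure_tensor3 K U W V u w v",
        OF swapped.tensor3_vectorspace swapped.pure_tensor3_linear(1,3,2)]
    by simp_all
qed

section \<open>Operators acting on two of three tensor factors\<close>

lemma leg12_linear:
  assumes R: "linear_map K (tensor K U V) (tensor K U V) R"
  shows "linear_map K (tensor3 K U V W) (tensor3 K U V W) (leg12 K U V W R)"
    and "\<lbrakk>u \<in> carrier U; v \<in> carrier V; w \<in> carrier W\<rbrakk> \<Longrightarrow>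
      leg12 K U V W R (pt3 u v w) = pure_tensor K (tensor K U V) W (R (pure_tensor K U V u v)) w"
  unfolding leg12_def tensor3_def pure_tensor3_def
  using UV_W.tensor_map_linear[OF R linear_map_id[OF W.vectorspace_axioms]] by simp_all

text \<open>The value stops at \<open>tensor_assoc_inv\<close>, since \<open>S\<close> of a pure
  tensor is in general not pure; it is expanded by linearity once \<open>S\<close> is known
  explicitly. The same holds for \<open>leg13_linear\<close>.\<close>

lemma leg23_linear:
  assumes S: "linear_map K (tensor K V W) (tensor K V W) S"
  shows "linear_map K (tensor3 K U V W) (tensor3 K U V W) (leg23 K U V W S)"
    and "\<lbrakk>u \<in> carrier U; v \<in> carrier V; w \<in> carrier W\<rbrakk> \<Longrightarrow>
      leg23 K U V W S (pt3 u v w) =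
        tensor_assoc_inv K U V W (pure_tensor K U (tensor K V W) u (S (pure_tensor K V W v w)))"
  unfolding leg23_def
  using U_VW.tensor_map_linear[OF linear_map_id[OF U.vectorspace_axioms] S]
    tensor_assoc_linear tensor_assoc_inv_linear
  by (auto intro!: linear_map_comp)

text \<open>Conjugation by the swap turns the action on factors 1 and 3 into \<open>leg12\<close>
  for the triple with \<open>V\<close> and \<open>W\<close> exchanged.\<close>

lemma leg13_linear:
  assumes S: "linear_map K (tensor K U W) (tensor K U W) S"
  shows "linear_map K (tensor3 K U V W) (tensor3 K U V W) (leg13 K U V W S)"
    and "\<lbrakk>u \<in> carrier U; v \<in> carrier V; w \<in> carrier W\<rbrakk> \<Longrightarrow>
      leg13 K U V W S (pt3 u v w) =
        tensor_swap23 K U W V (pure_tensor K (tensor K U W) V (S (pure_tensor K U W u w)) v)"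
proof -
  interpret swapped: vectorspace_triple K U W V ..
  show "linear_map K (tensor3 K U V W) (tensor3 K U V W) (leg13 K U V W S)"
    unfolding leg13_def
    by (rule linear_map_comp linear_map_comp tensor_swap23_linear swapped.leg12_linear[OF S]
        swapped.tensor_swap23_linear)+
  show "\<lbrakk>u \<in> carrier U; v \<in> carrier V; w \<in> carrier W\<rbrakk> \<Longrightarrow>
      leg13 K U V W S (pt3 u v w) =
        tensor_swap23 K U W V (pure_tensor K (tensor K U W) V (S (pure_tensor K U W u w)) v)"
    unfolding leg13_def by (simp add: tensor_swap23_linear(2) swapped.leg12_linear(2)[OF S])
qed

lemma yb_commutator_vanishesI:
  assumes R: "linear_map K (tensor K U V) (tensor K U V) R"
    and S: "linear_map K (tensor K U W) (tensor K U W) S"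
    and T: "linear_map K (tensor K V W) (tensor K V W) T"
    and eq: "\<And>u v w. \<lbrakk>u \<in> carrier U; v \<in> carrier V; w \<in> carrier W\<rbrakk> \<Longrightarrow>
      leg12 K U V W R (leg13 K U V W S (leg23 K U V W T (pt3 u v w))) =
      leg23 K U V W T (leg13 K U V W S (leg12 K U V W R (pt3 u v w)))"
  shows "yb_commutator_vanishes K U V W R S T"
  unfolding yb_commutator_vanishes_def yb_commutator_def Let_def
proof
  note legs = leg12_linear(1)[OF R] leg13_linear(1)[OF S] leg23_linear(1)[OF T]
  interpret T3: vectorspace K "tensor3 K U V W" by (rule tensor3_vectorspace)
  fix x assume x: "x \<in> carrier (tensor3 K U V W)"
  have "(leg12 K U V W R \<circ> leg13 K U V W S \<circ> leg23 K U V W T) x =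
      (leg23 K U V W T \<circ> leg13 K U V W S \<circ> leg12 K U V W R) x"
    by (rule tensor3_linear_map_eqI[OF linear_map_comp[OF legs(3) linear_map_comp[OF legs(2,1)]]
          linear_map_comp[OF legs(1) linear_map_comp[OF legs(2,3)]] _ x]) (simp add: eq)
  then show "(leg12 K U V W R \<circ> leg13 K U V W S \<circ> leg23 K U V W T) x
      \<ominus>\<^bsub>tensor3 K U V W\<^esub> (leg23 K U V W T \<circ> leg13 K U V W S \<circ> leg12 K U V W R) x
      = \<zero>\<^bsub>tensor3 K U V W\<^esub>"
    using x by (simp add: T3.minus_eq_zero_iff linear_mapD(3)[OF legs(1)]
        linear_mapD(3)[OF legs(2)] linear_mapD(3)[OF legs(3)])
qed

end

section \<open>The Yang-Baxter system\<close>

text \<open>Unlike \<^const>\<open>module.lincomb\<close>, this is indexed by a list, whose entries may coincide.\<close>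

definition (in module) lc :: "'c list \<Rightarrow> (nat \<Rightarrow> 'a) \<Rightarrow> 'c" where
  "lc es c = (\<Oplus>\<^bsub>M\<^esub>i\<in>{..<length es}. c i \<odot>\<^bsub>M\<^esub> (es ! i))"

context module
begin

lemma lc_add:
  assumes "set es \<subseteq> carrier M" "c \<in> {..<length es} \<rightarrow> carrier R" "d \<in> {..<length es} \<rightarrow> carrier R"
  shows "lc es c \<oplus>\<^bsub>M\<^esub> lc es d = lc es (\<lambda>i. c i \<oplus> d i)"
proof -
  have e: "es ! i \<in> carrier M" if "i < length es" for i using that assms(1) nth_mem by blast
  have "lc es (\<lambda>i. c i \<oplus> d i) =
      (\<Oplus>\<^bsub>M\<^esub>i\<in>{..<length es}. c i \<odot>\<^bsub>M\<^esub> (es ! i) \<oplus>\<^bsub>M\<^esub> d i \<odot>\<^bsub>M\<^esub> (es ! i))"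
    unfolding lc_def
    by (rule finsum_cong') (use assms e in \<open>auto simp: smult_l_distr Pi_iff\<close>)
  also have "\<dots> = lc es c \<oplus>\<^bsub>M\<^esub> lc es d"
    unfolding lc_def by (rule finsum_addf) (use assms e in \<open>auto simp: Pi_iff\<close>)
  finally show ?thesis ..
qed

lemma lc_smult:
  assumes "set es \<subseteq> carrier M" "c \<in> {..<length es} \<rightarrow> carrier R" "k \<in> carrier R"
  shows "k \<odot>\<^bsub>M\<^esub> lc es c = lc es (\<lambda>i. k \<otimes> c i)"
proof -
  have e: "es ! i \<in> carrier M" if "i < length es" for i using that assms(1) nth_mem by blast
  have "lc es (\<lambda>i. k \<otimes> c i) = (\<Oplus>\<^bsub>M\<^esub>i\<in>{..<length es}. k \<odot>\<^bsub>M\<^esub> (c i \<odot>\<^bsub>M\<^esub> (es ! i)))"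
    unfolding lc_def
    by (rule finsum_cong') (use assms e in \<open>auto simp: smult_assoc1 Pi_iff\<close>)
  also have "\<dots> = k \<odot>\<^bsub>M\<^esub> lc es c"
    unfolding lc_def by (rule finsum_smult[symmetric]) (use assms e in \<open>auto simp: Pi_iff\<close>)
  finally show ?thesis ..
qed

text \<open>Puts a single entry into \<open>lc\<close> form, so that \<open>lc_add\<close> and
  \<open>lc_smult\<close> can merge a whole expression into one coefficient function.\<close>

lemma lc_unit:
  assumes "set es \<subseteq> carrier M" "i < length es"
  shows "lc es (\<lambda>j. if j = i then \<one> else \<zero>) = es ! i"
proof -
  have e: "es ! j \<in> carrier M" if "j < length es" for j using that assms(1) nth_mem by blast
  have "lc es (\<lambda>j. if j = i then \<one> else \<zero>) =
      (\<Oplus>\<^bsub>M\<^esub>j\<in>{..<length es}. if i = j then es ! j else \<zero>\<^bsub>M\<^esub>)"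
    unfolding lc_def by (rule finsum_cong') (use e in auto)
  also have "\<dots> = es ! i"
    by (rule finsum_singleton) (use assms e in auto)
  finally show ?thesis .
qed

text \<open>Only this direction holds in general, since the entries may be linearly
  dependent.\<close>

lemma lc_cong:
  assumes es: "set es \<subseteq> carrier M" and d: "d \<in> {..<length es} \<rightarrow> carrier R"
    and eq: "\<And>i. i < length es \<Longrightarrow> c i = d i"
  shows "lc es c = lc es d"
proof -
  have e: "es ! j \<in> carrier M" if "j < length es" for j using that es nth_mem by blast
  show ?thesis
    unfolding lc_def by (rule finsum_cong') (use e d eq in \<open>auto simp: Pi_iff\<close>)
qed

end

section \<open>The operators \<open>R\<^sub>p\<^sub>,\<^sub>q\<close> on an algebra and their
  commutators\<close>

context unital_algebra
begin

sublocale A3: vectorspace_triple K A A A ..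

abbreviation AA where "AA \<equiv> tensor K A A"
abbreviation AAA where "AAA \<equiv> tensor3 K A A A"
abbreviation pair (infixl \<open>\<otimes>\<^sub>2\<close> 75) where "a \<otimes>\<^sub>2 b \<equiv> pure_tensor K A A a b"
abbreviation triple where "triple \<equiv> pure_tensor3 K A A A"

definition yb_op :: "'a \<Rightarrow> 'a \<Rightarrow> 'c \<Rightarrow> 'c \<Rightarrow> ('c \<times> 'c \<Rightarrow> 'a) set" where
  "yb_op p q a b = (p \<odot>\<^bsub>AA\<^esub> (\<one>\<^bsub>A\<^esub> \<otimes>\<^sub>2 (a \<otimes>\<^bsub>A\<^esub> b)) \<oplus>\<^bsub>AA\<^esub> q \<odot>\<^bsub>AA\<^esub> ((a \<otimes>\<^bsub>A\<^esub> b) \<otimes>\<^sub>2 \<one>\<^bsub>A\<^esub>))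
     \<ominus>\<^bsub>AA\<^esub> b \<otimes>\<^sub>2 a"

lemma mult_bilinear: "bilinear_on K A A A (\<otimes>\<^bsub>A\<^esub>)"
  unfolding bilinear_on_def
  by (auto intro!: linear_mapI simp: vectorspace_axioms A.l_distr A.r_distr smult_mult_left smult_mult_right)

lemma yb_op_bilinear:
  assumes "p \<in> carrier K" "q \<in> carrier K"
  shows "bilinear_on K A A AA (yb_op p q)"
proof -
  note pt = A3.UV.pure_tensor_bilinear
  have "bilinear_on K A A AA (\<lambda>a b. b \<otimes>\<^sub>2 a)"
    using pt by (simp add: bilinear_on_def)
  then show ?thesis
    unfolding yb_op_def
    by (intro A3.UV.T.bilinear_on_add A3.UV.T.bilinear_on_smult A3.UV.T.bilinear_on_diff
        bilinear_on_compose[OF mult_bilinear] bilinear_onD[OF pt] assms) auto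
qed

text \<open>Subtraction is written as addition of a multiple by \<open>-1\<close>, because the later
  collection of coefficients handles sums and scalings only. Each leg is a linear function of the
  value of \<open>R\<close> on a pure tensor, so it distributes over the three terms.\<close>

lemma yb_op_legs:
  assumes "tensor_induced K A A AA (yb_op p q) R"
    and [simp]: "p \<in> carrier K" "q \<in> carrier K" "a \<in> carrier A" "b \<in> carrier A" "c \<in> carrier A"
  shows "leg12 K A A A R (triple a b c) =
      p \<odot>\<^bsub>AAA\<^esub> triple \<one>\<^bsub>A\<^esub> (a \<otimes>\<^bsub>A\<^esub> b) c \<oplus>\<^bsub>AAA\<^esub>
        (q \<odot>\<^bsub>AAA\<^esub> triple (a \<otimes>\<^bsub>A\<^esub> b) \<one>\<^bsub>A\<^esub> c \<oplus>\<^bsub>AAA\<^esub> (\<ominus>\<^bsub>K\<^esub> \<one>\<^bsub>K\<^esub>) \<odot>\<^bsub>AAA\<^esub> triple b a c)"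
    and "leg13 K A A A R (triple a b c) =
      p \<odot>\<^bsub>AAA\<^esub> triple \<one>\<^bsub>A\<^esub> b (a \<otimes>\<^bsub>A\<^esub> c) \<oplus>\<^bsub>AAA\<^esub>
        (q \<odot>\<^bsub>AAA\<^esub> triple (a \<otimes>\<^bsub>A\<^esub> c) b \<one>\<^bsub>A\<^esub> \<oplus>\<^bsub>AAA\<^esub> (\<ominus>\<^bsub>K\<^esub> \<one>\<^bsub>K\<^esub>) \<odot>\<^bsub>AAA\<^esub> triple c b a)"
    and "leg23 K A A A R (triple a b c) =
      p \<odot>\<^bsub>AAA\<^esub> triple a \<one>\<^bsub>A\<^esub> (b \<otimes>\<^bsub>A\<^esub> c) \<oplus>\<^bsub>AAA\<^esub>
        (q \<odot>\<^bsub>AAA\<^esub> triple a (b \<otimes>\<^bsub>A\<^esub> c) \<one>\<^bsub>A\<^esub> \<oplus>\<^bsub>AAA\<^esub> (\<ominus>\<^bsub>K\<^esub> \<one>\<^bsub>K\<^esub>) \<odot>\<^bsub>AAA\<^esub> triple a c b)"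
proof -
  interpret T3: vectorspace K AAA by (rule A3.tensor3_vectorspace)
  have R: "linear_map K AA AA R"
    using assms(1) by (simp add: tensor_induced_def)
  have R_pure: "R (x \<otimes>\<^sub>2 y) = p \<odot>\<^bsub>AA\<^esub> (\<one>\<^bsub>A\<^esub> \<otimes>\<^sub>2 (x \<otimes>\<^bsub>A\<^esub> y)) \<oplus>\<^bsub>AA\<^esub>
      (q \<odot>\<^bsub>AA\<^esub> ((x \<otimes>\<^bsub>A\<^esub> y) \<otimes>\<^sub>2 \<one>\<^bsub>A\<^esub>) \<oplus>\<^bsub>AA\<^esub> (\<ominus>\<^bsub>K\<^esub> \<one>\<^bsub>K\<^esub>) \<odot>\<^bsub>AA\<^esub> (y \<otimes>\<^sub>2 x))"
    if "x \<in> carrier A" "y \<in> carrier A" for x y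
    using assms(1) that
    by (simp add: tensor_induced_def yb_op_def A3.UV.T.smult_minus_1 a_minus_def A3.UV.T.a_assoc)
  have lin12: "linear_map K AA AAA (\<lambda>x. pure_tensor K AA A x z)" if "z \<in> carrier A" for z
    unfolding tensor3_def using that by (rule bilinear_onD[OF A3.UV_W.pure_tensor_bilinear])
  have lin13: "linear_map K AA AAA (\<lambda>x. tensor_swap23 K A A A (pure_tensor K AA A x z))"
    if "z \<in> carrier A" for z
    using linear_map_comp[OF lin12[OF that] A3.tensor_swap23_linear(1)] by (simp add: comp_def)
  have lin23: "linear_map K AA AAA (\<lambda>x. tensor_assoc_inv K A A A (pure_tensor K A AA z x))"
    if "z \<in> carrier A" for z
    using linear_map_comp[OF bilinear_onD(1)[OF A3.U_VW.pure_tensor_bilinear that]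
        A3.tensor_assoc_inv_linear(1)] by (simp add: comp_def)
  show "leg12 K A A A R (triple a b c) =
      p \<odot>\<^bsub>AAA\<^esub> triple \<one>\<^bsub>A\<^esub> (a \<otimes>\<^bsub>A\<^esub> b) c \<oplus>\<^bsub>AAA\<^esub>
        (q \<odot>\<^bsub>AAA\<^esub> triple (a \<otimes>\<^bsub>A\<^esub> b) \<one>\<^bsub>A\<^esub> c \<oplus>\<^bsub>AAA\<^esub> (\<ominus>\<^bsub>K\<^esub> \<one>\<^bsub>K\<^esub>) \<odot>\<^bsub>AAA\<^esub> triple b a c)"
    by (simp add: A3.leg12_linear(2)[OF R] R_pure linear_mapD[OF lin12] flip: pure_tensor3_def)
  show "leg13 K A A A R (triple a b c) =
      p \<odot>\<^bsub>AAA\<^esub> triple \<one>\<^bsub>A\<^esub> b (a \<otimes>\<^bsub>A\<^esub> c) \<oplus>\<^bsub>AAA\<^esub>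
        (q \<odot>\<^bsub>AAA\<^esub> triple (a \<otimes>\<^bsub>A\<^esub> c) b \<one>\<^bsub>A\<^esub> \<oplus>\<^bsub>AAA\<^esub> (\<ominus>\<^bsub>K\<^esub> \<one>\<^bsub>K\<^esub>) \<odot>\<^bsub>AAA\<^esub> triple c b a)"
    by (simp add: A3.leg13_linear(2)[OF R] R_pure linear_mapD[OF lin13] A3.tensor_swap23_linear(2)
        flip: pure_tensor3_def)
  show "leg23 K A A A R (triple a b c) =
      p \<odot>\<^bsub>AAA\<^esub> triple a \<one>\<^bsub>A\<^esub> (b \<otimes>\<^bsub>A\<^esub> c) \<oplus>\<^bsub>AAA\<^esub>
        (q \<odot>\<^bsub>AAA\<^esub> triple a (b \<otimes>\<^bsub>A\<^esub> c) \<one>\<^bsub>A\<^esub> \<oplus>\<^bsub>AAA\<^esub> (\<ominus>\<^bsub>K\<^esub> \<one>\<^bsub>K\<^esub>) \<odot>\<^bsub>AAA\<^esub> triple a c b)"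
    by (simp add: A3.leg23_linear(2)[OF R] R_pure linear_mapD[OF lin23] A3.tensor_assoc_inv_linear(2))
qed

text \<open>With positions counted as in \<open>es\<close>, the coefficients at 0, 2, 5, 6, 9 are
  \<open>rt(p+q-1)\<close>, \<open>qs(t+u-1)\<close>, \<open>-us\<close>, \<open>-pr\<close>,
  \<open>-1\<close> on both sides for all parameters. The other five give conditions: if
  \<open>q = s = u = 1\<close> they reduce to \<open>(r-t)(p-1) = 0\<close>, and if
  \<open>p = r = t = 1\<close> to \<open>(s-q)(u-1) = 0\<close>. Taking \<open>t = r\<close>,
  respectively \<open>s = q\<close>, satisfies them.\<close>

lemma yb_op_yang_baxter:
  assumes R: "tensor_induced K A A AA (yb_op p q) R"
    and S: "tensor_induced K A A AA (yb_op r s) S"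
    and T: "tensor_induced K A A AA (yb_op t u) T"
    and coeffs [simp]: "p \<in> carrier K" "q \<in> carrier K" "r \<in> carrier K" "s \<in> carrier K"
      "t \<in> carrier K" "u \<in> carrier K"
    and params: "q = \<one>\<^bsub>K\<^esub> \<and> s = \<one>\<^bsub>K\<^esub> \<and> u = \<one>\<^bsub>K\<^esub> \<and> t = r \<or> p = \<one>\<^bsub>K\<^esub> \<and> r = \<one>\<^bsub>K\<^esub> \<and> t = \<one>\<^bsub>K\<^esub> \<and> s = q"
  shows "yb_commutator_vanishes K A A A R S T"
proof (rule A3.yb_commutator_vanishesI)
  show R': "linear_map K AA AA R" and S': "linear_map K AA AA S" and T': "linear_map K AA AA T"
    using R S T by (simp_all add: tensor_induced_def)
  interpret T3: vectorspace K AAA by (rule A3.tensor3_vectorspace)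
  fix a b c assume abc [simp]: "a \<in> carrier A" "b \<in> carrier A" "c \<in> carrier A"
  \<comment> \<open>\<open>es\<close> is obtained, not abbreviated: it must stay opaque, or the rules \<open>units\<close> would rewrite their own
    right-hand sides.\<close>
  obtain es where es: "es = [triple \<one>\<^bsub>A\<^esub> \<one>\<^bsub>A\<^esub> (a \<otimes>\<^bsub>A\<^esub> (b \<otimes>\<^bsub>A\<^esub> c)),
    triple \<one>\<^bsub>A\<^esub> (a \<otimes>\<^bsub>A\<^esub> (b \<otimes>\<^bsub>A\<^esub> c)) \<one>\<^bsub>A\<^esub>, triple (a \<otimes>\<^bsub>A\<^esub> (b \<otimes>\<^bsub>A\<^esub> c)) \<one>\<^bsub>A\<^esub> \<one>\<^bsub>A\<^esub>,
    triple \<one>\<^bsub>A\<^esub> (b \<otimes>\<^bsub>A\<^esub> c) a, triple (b \<otimes>\<^bsub>A\<^esub> c) \<one>\<^bsub>A\<^esub> a, triple (b \<otimes>\<^bsub>A\<^esub> c) a \<one>\<^bsub>A\<^esub>,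
    triple \<one>\<^bsub>A\<^esub> c (a \<otimes>\<^bsub>A\<^esub> b), triple c \<one>\<^bsub>A\<^esub> (a \<otimes>\<^bsub>A\<^esub> b), triple c (a \<otimes>\<^bsub>A\<^esub> b) \<one>\<^bsub>A\<^esub>,
    triple c b a]" by simp
  have len: "length es = 10" and es_closed: "set es \<subseteq> carrier AAA" by (simp_all add: es)
  note unit = T3.lc_unit[OF es_closed, unfolded len, symmetric]
  have units:
    "triple \<one>\<^bsub>A\<^esub> \<one>\<^bsub>A\<^esub> (a \<otimes>\<^bsub>A\<^esub> (b \<otimes>\<^bsub>A\<^esub> c)) = T3.lc es (\<lambda>j. if j = 0 then \<one>\<^bsub>K\<^esub> else \<zero>\<^bsub>K\<^esub>)"
    "triple \<one>\<^bsub>A\<^esub> (a \<otimes>\<^bsub>A\<^esub> (b \<otimes>\<^bsub>A\<^esub> c)) \<one>\<^bsub>A\<^esub> = T3.lc es (\<lambda>j. if j = 1 then \<one>\<^bsub>K\<^esub> else \<zero>\<^bsub>K\<^esub>)"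
    "triple (a \<otimes>\<^bsub>A\<^esub> (b \<otimes>\<^bsub>A\<^esub> c)) \<one>\<^bsub>A\<^esub> \<one>\<^bsub>A\<^esub> = T3.lc es (\<lambda>j. if j = 2 then \<one>\<^bsub>K\<^esub> else \<zero>\<^bsub>K\<^esub>)"
    "triple \<one>\<^bsub>A\<^esub> (b \<otimes>\<^bsub>A\<^esub> c) a = T3.lc es (\<lambda>j. if j = 3 then \<one>\<^bsub>K\<^esub> else \<zero>\<^bsub>K\<^esub>)"
    "triple (b \<otimes>\<^bsub>A\<^esub> c) \<one>\<^bsub>A\<^esub> a = T3.lc es (\<lambda>j. if j = 4 then \<one>\<^bsub>K\<^esub> else \<zero>\<^bsub>K\<^esub>)"
    "triple (b \<otimes>\<^bsub>A\<^esub> c) a \<one>\<^bsub>A\<^esub> = T3.lc es (\<lambda>j. if j = 5 then \<one>\<^bsub>K\<^esub> else \<zero>\<^bsub>K\<^esub>)"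
    "triple \<one>\<^bsub>A\<^esub> c (a \<otimes>\<^bsub>A\<^esub> b) = T3.lc es (\<lambda>j. if j = 6 then \<one>\<^bsub>K\<^esub> else \<zero>\<^bsub>K\<^esub>)"
    "triple c \<one>\<^bsub>A\<^esub> (a \<otimes>\<^bsub>A\<^esub> b) = T3.lc es (\<lambda>j. if j = 7 then \<one>\<^bsub>K\<^esub> else \<zero>\<^bsub>K\<^esub>)"
    "triple c (a \<otimes>\<^bsub>A\<^esub> b) \<one>\<^bsub>A\<^esub> = T3.lc es (\<lambda>j. if j = 8 then \<one>\<^bsub>K\<^esub> else \<zero>\<^bsub>K\<^esub>)"
    "triple c b a = T3.lc es (\<lambda>j. if j = 9 then \<one>\<^bsub>K\<^esub> else \<zero>\<^bsub>K\<^esub>)"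
    using unit[of 0] unit[of 1] unit[of 2] unit[of 3] unit[of 4] unit[of 5] unit[of 6] unit[of 7]
      unit[of 8] unit[of 9]
    by (simp_all add: es)
  note R_simps = yb_op_legs(1)[OF R coeffs(1,2)] linear_mapD[OF A3.leg12_linear(1)[OF R']]
  note S_simps = yb_op_legs(2)[OF S coeffs(3,4)] linear_mapD[OF A3.leg13_linear(1)[OF S']]
  note T_simps = yb_op_legs(3)[OF T coeffs(5,6)] linear_mapD[OF A3.leg23_linear(1)[OF T']]
  note lc_simps = T3.lc_add[OF es_closed] T3.lc_smult[OF es_closed] len Pi_iff
  \<comment> \<open>Sorting sums can leave another summand between a term and its negative, where
    the standard cancellation rules do not match.\<close>
  have cancel: "x \<oplus>\<^bsub>K\<^esub> (y \<oplus>\<^bsub>K\<^esub> (\<ominus>\<^bsub>K\<^esub> x \<oplus>\<^bsub>K\<^esub> z)) = y \<oplus>\<^bsub>K\<^esub> z"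
    if "x \<in> carrier K" "y \<in> carrier K" "z \<in> carrier K" for x y z
    using that by (simp add: R.a_lcomm[of x y] R.r_neg2)
  show "leg12 K A A A R (leg13 K A A A S (leg23 K A A A T (triple a b c))) =
    leg23 K A A A T (leg13 K A A A S (leg12 K A A A R (triple a b c)))"
    \<comment> \<open>Associativity brings every triple product to the form \<open>a(bc)\<close>
      used in \<open>es\<close>; unit laws simplify products with 1.\<close>
    apply (simp add: R_simps S_simps T_simps A.m_assoc)
    \<comment> \<open>collects the coefficients of the ten pure tensors on both sides\<close>
    apply (simp add: units lc_simps)
    apply (rule T3.lc_cong[OF es_closed])
     apply (simp add: Pi_iff)
    apply (unfold len)
    using params
    \<comment> \<open>The bound on the index becomes a disjunction over the ten positions; each is
      then checked in both parameter cases.\<close>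
    apply (simp add: eval_nat_numeral less_Suc_eq)
    apply (elim disjE conjE; simp add: R.l_minus R.r_minus R.l_distr R.r_distr R.m_ac
        R.l_neg R.r_neg R.r_neg1 R.r_neg2 R.minus_add R.a_ac cancel)
    done
qed

text \<open>\<open>yb_op\<close> carries explicit coefficients 1 that the stated formulas omit. The
  two agree only for arguments in the carrier, so a congruence rule replaces rewriting.\<close>

lemma tensor_induced_cong:
  assumes "\<And>a b. a \<in> carrier A \<Longrightarrow> b \<in> carrier A \<Longrightarrow> f a b = f' a b"
  shows "tensor_induced K A A U f g \<longleftrightarrow> tensor_induced K A A U f' g"
  using assms by (auto simp: tensor_induced_def)

end

theorem theorem5p2:
  fixes K :: "('k, 'r) ring_scheme"
    and A :: "('k, 'a, 'm) module_scheme"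
    and l m :: 'k
  assumes "unital_algebra K A"
    and "l \<in> carrier K" and "m \<in> carrier K"
  shows
    "let T = tensor K A A;
         t = pure_tensor K A A;
         w = (\<lambda>a b. (l \<odot>\<^bsub>T\<^esub> t \<one>\<^bsub>A\<^esub> (a \<otimes>\<^bsub>A\<^esub> b) \<oplus>\<^bsub>T\<^esub> t (a \<otimes>\<^bsub>A\<^esub> b) \<one>\<^bsub>A\<^esub>) \<ominus>\<^bsub>T\<^esub> t b a);
         z = (\<lambda>a b. (t \<one>\<^bsub>A\<^esub> (a \<otimes>\<^bsub>A\<^esub> b) \<oplus>\<^bsub>T\<^esub> m \<odot>\<^bsub>T\<^esub> t (a \<otimes>\<^bsub>A\<^esub> b) \<one>\<^bsub>A\<^esub>) \<ominus>\<^bsub>T\<^esub> t b a);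
         x = (\<lambda>a b. (t \<one>\<^bsub>A\<^esub> (a \<otimes>\<^bsub>A\<^esub> b) \<oplus>\<^bsub>T\<^esub> t (a \<otimes>\<^bsub>A\<^esub> b) \<one>\<^bsub>A\<^esub>) \<ominus>\<^bsub>T\<^esub> t b a)
     in (\<exists>W. tensor_induced K A A T w W) \<and>
        (\<exists>Z. tensor_induced K A A T z Z) \<and>
        (\<exists>X. tensor_induced K A A T x X) \<and>
        (\<forall>W Z X. tensor_induced K A A T w W \<and> tensor_induced K A A T z Z \<and>
                 tensor_induced K A A T x X \<longrightarrow> wxz_system K A A W X Z)"
proof -
  interpret unital_algebra K A by fact
  let ?w = "\<lambda>a b. (l \<odot>\<^bsub>AA\<^esub> \<one>\<^bsub>A\<^esub> \<otimes>\<^sub>2 (a \<otimes>\<^bsub>A\<^esub> b) \<oplus>\<^bsub>AA\<^esub> (a \<otimes>\<^bsub>A\<^esub> b) \<otimes>\<^sub>2 \<one>\<^bsub>A\<^esub>) \<ominus>\<^bsub>AA\<^esub> b \<otimes>\<^sub>2 a"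
  let ?z = "\<lambda>a b. (\<one>\<^bsub>A\<^esub> \<otimes>\<^sub>2 (a \<otimes>\<^bsub>A\<^esub> b) \<oplus>\<^bsub>AA\<^esub> m \<odot>\<^bsub>AA\<^esub> (a \<otimes>\<^bsub>A\<^esub> b) \<otimes>\<^sub>2 \<one>\<^bsub>A\<^esub>) \<ominus>\<^bsub>AA\<^esub> b \<otimes>\<^sub>2 a"
  let ?x = "\<lambda>a b. (\<one>\<^bsub>A\<^esub> \<otimes>\<^sub>2 (a \<otimes>\<^bsub>A\<^esub> b) \<oplus>\<^bsub>AA\<^esub> (a \<otimes>\<^bsub>A\<^esub> b) \<otimes>\<^sub>2 \<one>\<^bsub>A\<^esub>) \<ominus>\<^bsub>AA\<^esub> b \<otimes>\<^sub>2 a"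
  have induced:
    "tensor_induced K A A AA ?w W \<longleftrightarrow> tensor_induced K A A AA (yb_op l \<one>\<^bsub>K\<^esub>) W"
    "tensor_induced K A A AA ?z W \<longleftrightarrow> tensor_induced K A A AA (yb_op \<one>\<^bsub>K\<^esub> m) W"
    "tensor_induced K A A AA ?x W \<longleftrightarrow> tensor_induced K A A AA (yb_op \<one>\<^bsub>K\<^esub> \<one>\<^bsub>K\<^esub>) W" for W
    by (rule tensor_induced_cong; simp add: yb_op_def)+
  have ex: "\<exists>W. tensor_induced K A A AA (yb_op p q) W"
    if "p \<in> carrier K" "q \<in> carrier K" for p q
    by (rule A3.UV.tensor_induced_exists[OF yb_op_bilinear[OF that] A3.UV.T.vectorspace_axioms])
  have wxz: "wxz_system K A A W X Z"
    if W: "tensor_induced K A A AA (yb_op l \<one>\<^bsub>K\<^esub>) W"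
      and Z: "tensor_induced K A A AA (yb_op \<one>\<^bsub>K\<^esub> m) Z"
      and X: "tensor_induced K A A AA (yb_op \<one>\<^bsub>K\<^esub> \<one>\<^bsub>K\<^esub>) X" for W X Z
    unfolding wxz_system_def
    \<comment> \<open>\<open>[W,W,W]\<close> and \<open>[W,X,X]\<close> use the first parameter
      case, \<open>[Z,Z,Z]\<close> and \<open>[X,X,Z]\<close> the second.\<close>
    using W Z X yb_op_yang_baxter[OF W W W] yb_op_yang_baxter[OF Z Z Z]
      yb_op_yang_baxter[OF W X X] yb_op_yang_baxter[OF X X Z] assms(2,3)
    by (simp add: tensor_induced_def)
  show ?thesis
    unfolding Let_def induced using ex wxz assms(2,3) by blast
qed

end
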